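(* Let $f:[1,\infty)\to\mathbb{R}$ be a uniform continuation of $F$. Then there is a sequence $K$ of positive integers approaching $\infty$, for example $K_n=\lfloor\mathfrak F(n+\mathfrak F_n^{-1}(f_n(\{n\pi\})))\rfloor$, such that $\{f^{-1}(K_n)\}$ is equidistributed. Moreover, let $K$ be any sequence of positive integers approaching $\infty$ such that $\{f^{-1}(K_n)\}$ is equidistributed, let $s\ge2$ and $\mathbf b\in\mathcal F_s$. Then $$\lim_{n\to\infty}\frac{\#\{k\le n:\mathrm{LB}_s(K_k)=\mathbf b\}}{n}=f_\infty^{-1}\circ\mathfrak F_\infty(\log_\phi\widetilde{\mathbf b}\cdot\widehat F)-f_\infty^{-1}\circ\mathfrak F_\infty(\log_\phi\mathbf b\cdot\widehat F)=f_\infty^{-1}\big(\phi(\widetilde{\mathbf b}\cdot\widehat F-1)\big)-f_\infty^{-1}\big(\phi(\mathbf b\cdot\widehat F-1)\big).$$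
   Context: $F$: $F_1=1,F_2=2,F_{n+2}=F_{n+1}+F_n$; $\phi$ golden ratio, $\omega=\phi^{-1}$. A uniform continuation of $F$ is an increasing continuous $f:[1,\infty)\to\mathbb{R}$ with $f(n)=F_n$ such that $f_n(p)=\frac{f(n+p)-f(n)}{f(n+1)-f(n)}$ converges uniformly on $[0,1]$ to an increasing continuous function $f_\infty:[0,1]\to[0,1]$. $\mathfrak F(x)=\frac{\phi}{\sqrt5}(\phi^x+\phi^{-x}\cos(\pi x)\phi^{-2})$ (increasing on $[1,\infty)$, $\mathfrak F(n)=F_n$); $\mathfrak F_n(p)=\frac{\mathfrak F(n+p)-\mathfrak F(n)}{F_{n+1}-F_n}$ and $\mathfrak F_\infty(p)=\phi(\phi^p-1)$ on $[0,1]$. Zeckendorf expansion $m=\sum_{k=1}^M\epsilon(k)F_{M-k+1}$ (unique, $\epsilon(k)\in\{0,1\}$, $\epsilon(1)=1$, $\epsilon(k)\epsilon(k+1)=0$); $\mathrm{LB}_s(m)=(\epsilon(1),\dots,\epsilon(s))$ if $M\ge s$. $\mathcal F_s$: all $\mathrm{LB}_s(m)$, listed $\mathbf b_1,\dots,\mathbf b_\ell$ with $1+\mathbf b_k*F=\mathbf b_{k+1}*F$, $\mathbf b*F=\sum_k\mathbf b(k)F_{s-k+1}$; $\mathbf b_{\ell+1}:=(1,0,1,0,\dots,1,0,1,1)$ if $s$ even, $(1,0,1,0,\dots,1,1,0)$ if $s$ odd; $\widetilde{\mathbf b_k}=\mathbf b_{k+1}$; $\mathbf b\cdot\widehat F=\sum_k\mathbf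 b(k)\omega^{k-1}$. $\{x_n\}$ equidistributed means $\lim_n\#\{k\le n:\{x_k\}\le\beta\}/n=\beta$ for all $\beta\in[0,1]$. *)

theory Defs
  imports "HOL-Analysis.Analysis"
begin

text \<open>Fibonacci-type sequence F with F 1 = 1, F 2 = 2, F (n+2) = F (n+1) + F n.
  (The value FF 0 = 1 is a convention making the recursion uniform; it is never used.)\<close>
fun FF :: "nat \<Rightarrow> nat" where
  "FF 0 = 1"
| "FF (Suc 0) = 1"
| "FF (Suc (Suc n)) = FF (Suc n) + FF n"

definition phi :: real where "phi = (1 + sqrt 5) / 2"
definition omega :: real where "omega = inverse phi"

definition fn_seq :: "(real \<Rightarrow> real) \<Rightarrow> nat \<Rightarrow> real \<Rightarrow> real" where
  "fn_seq f n p = (f (real n + p) - f (real n)) / (f (real n + 1) - f (real n))"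

definition uniform_continuation :: "(real \<Rightarrow> real) \<Rightarrow> (real \<Rightarrow> real) \<Rightarrow> bool" where
  "uniform_continuation f finf \<longleftrightarrow>
     strict_mono_on {1..} f \<and> continuous_on {1..} f \<and>
     (\<forall>n::nat. n \<ge> 1 \<longrightarrow> f (real n) = real (FF n)) \<and>
     uniform_limit {0..1} (\<lambda>n p. fn_seq f n p) finf sequentially \<and>
     strict_mono_on {0..1} finf \<and> continuous_on {0..1} finf \<and> finf ` {0..1} \<subseteq> {0..1}"

definition FrakF :: "real \<Rightarrow> real" where
  "FrakF x = phi / sqrt 5 * (phi powr x + phi powr (- x) * cos (pi * x) * phi powr (-2))"

definition FrakFn :: "nat \<Rightarrow> real \<Rightarrow> real" where
  "FrakFn n p = (FrakF (real n + p) - FrakF (real n)) / (real (FF (n + 1)) - real (FF n))"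

definition FrakFinf :: "real \<Rightarrow> real" where
  "FrakFinf p = phi * (phi powr p - 1)"

definition equidistributed :: "(nat \<Rightarrow> real) \<Rightarrow> bool" where
  "equidistributed x \<longleftrightarrow>
     (\<forall>\<beta>\<in>{0..1}. (\<lambda>n. real (card {k \<in> {1..n}. frac (x k) \<le> \<beta>}) / real n) \<longlonglongrightarrow> \<beta>)"

definition zeck_rep :: "nat \<Rightarrow> nat \<Rightarrow> (nat \<Rightarrow> nat) \<Rightarrow> bool" where
  "zeck_rep m M eps \<longleftrightarrow> M \<ge> 1 \<and> eps 1 = 1 \<and> (\<forall>k\<in>{1..M}. eps k \<in> {0, 1}) \<and>
     (\<forall>k\<in>{1..<M}. eps k * eps (k + 1) = 0) \<and>
     m = (\<Sum>k=1..M. eps k * FF (M - k + 1))"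

text \<open>The (unique) Zeckendorf expansion, with eps normalized to 0 outside {1..M}.\<close>
definition zeck_exp :: "nat \<Rightarrow> nat \<times> (nat \<Rightarrow> nat)" where
  "zeck_exp m = (THE (M, eps). zeck_rep m M eps \<and> (\<forall>k. (k = 0 \<or> M < k) \<longrightarrow> eps k = 0))"

definition LB :: "nat \<Rightarrow> nat \<Rightarrow> nat list option" where
  "LB s m = (if m = 0 then None else
     (case zeck_exp m of (M, eps) \<Rightarrow> if s \<le> M then Some (map eps [1..<s+1]) else None))"

definition FS :: "nat \<Rightarrow> nat list set" where
  "FS s = {b. \<exists>m. m \<ge> 1 \<and> LB s m = Some b}"

definition dotF :: "nat list \<Rightarrow> nat" where
  "dotF b = (\<Sum>k=1..length b. b ! (k - 1) * FF (length b - k + 1))"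

definition dotFhat :: "nat list \<Rightarrow> real" where
  "dotFhat b = (\<Sum>k=1..length b. real (b ! (k - 1)) * omega ^ (k - 1))"

text \<open>b_{l+1}: (1,0,...,1,0,1,1) if s even, (1,0,...,1,0,1,1,0) if s odd.\<close>
definition bspecial :: "nat \<Rightarrow> nat list" where
  "bspecial s = map (\<lambda>k. if even s then (if odd k \<or> k = s then 1 else 0)
                         else (if k = s then 0 else if k = s - 1 then 1 else if odd k then 1 else 0))
                    [1..<s+1]"

text \<open>The successor b~ of b in the listing of F_s (ordered by b*F).\<close>
definition btilde :: "nat \<Rightarrow> nat list \<Rightarrow> nat list" where
  "btilde s b = (if \<exists>b'\<in>FS s. dotF b' = dotF b + 1
                 then (THE b'. b' \<in> FS s \<and> dotF b' = dotF b + 1)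
                 else bspecial s)"

end

theory Submission
  imports Defs
begin

text \<open>Since \<open>f\<close> and \<open>FrakF\<close> agree at the integers, \<open>FrakF (n + FrakFn n\<inverse> (f\<^sub>n p)) = f (n + p)\<close>, so the
  proposed \<open>K n\<close> is the integer part of \<open>f (n + frac (n * pi))\<close>. Rounding moves the value of \<open>f\<^sub>n\<close> by
  at most \<open>1 / F\<^sub>n\<^sub>-\<^sub>1\<close>, hence by uniform convergence to the strictly increasing \<open>f\<^sub>\<infinity>\<close> it does not
  affect the limit distribution, which is that of \<open>n * pi\<close>: uniform, because pi is irrational.

  For the second part, an integer \<open>m\<close> with \<open>F\<^sub>M \<le> m < F\<^sub>M\<^sub>+\<^sub>1\<close> has leading block \<open>b\<close> iff it lies
  between the cuts obtained from \<open>b\<close> and its successor by appending \<open>M - s\<close> zeros. In the coordinate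
  \<open>(m - F\<^sub>M) / (F\<^sub>M\<^sub>+\<^sub>1 - F\<^sub>M) = f\<^sub>M (frac (f\<inverse> m))\<close> the cut of a word \<open>c\<close> converges to
  \<open>phi * (dotFhat c - 1)\<close>, so in the limit the condition says that \<open>frac (f\<inverse> m)\<close> lies between
  the \<open>f\<^sub>\<infinity>\<close>-preimages of these two numbers.\<close>

section \<open>Irrationality of pi\<close>

lemma Ints_coeff_mult:
  fixes p q :: "'a::comm_ring_1 poly"
  assumes "\<And>i. coeff p i \<in> \<int>" "\<And>i. coeff q i \<in> \<int>"
  shows "coeff (p * q) i \<in> \<int>"
  unfolding coeff_mult using assms by (intro Ints_sum Ints_mult) auto

lemma Ints_coeff_power:
  fixes p :: "'a::comm_ring_1 poly"
  assumes "\<And>i. coeff p i \<in> \<int>"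
  shows "coeff (p ^ n) i \<in> \<int>"
proof (induction n arbitrary: i)
  case 0
  then show ?case by (cases i) auto
next
  case (Suc n)
  then show ?case using assms by (auto intro!: Ints_coeff_mult)
qed

text \<open>Each differentiation of the symmetry \<open>p(c - x) = p(x)\<close> contributes one
  sign. With \<open>c = pi\<close> and even order this carries integrality of derivatives from the
  point 0 to the point pi.\<close>

lemma higher_pderiv_reflect:
  fixes p :: "real poly"
  assumes "pcompose p [:c, -1:] = p"
  shows "poly ((pderiv ^^ k) p) (c - x) = (-1) ^ k * poly ((pderiv ^^ k) p) x"
proof -
  have "pcompose ((pderiv ^^ k) p) [:c, -1:] = smult ((-1) ^ k) ((pderiv ^^ k) p)"
  proof (induction k)
    case (Suc k)
    have "- pcompose (pderiv ((pderiv ^^ k) p)) [:c, -1:] = pderiv (pcompose ((pderiv ^^ k) p) [:c, -1:])"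
      by (simp add: pderiv_pcompose pderiv_pCons)
    also have "\<dots> = smult ((-1) ^ k) (pderiv ((pderiv ^^ k) p))"
      by (simp add: Suc pderiv_smult)
    finally show ?case
      by (simp add: minus_equation_iff[of _ "smult _ _"])
  qed (use assms in simp)
  then have "poly (pcompose ((pderiv ^^ k) p) [:c, -1:]) x = poly (smult ((-1) ^ k) ((pderiv ^^ k) p)) x"
    by simp
  then show ?thesis by (simp add: poly_pcompose)
qed

text \<open>Niven's argument. For \<open>f = x ^ n * (a - b * x) ^ n / n!\<close> and the alternating sum \<open>F\<close> of its even
  derivatives, \<open>F' sin - F cos\<close> has derivative \<open>f sin\<close>; if \<open>pi = a / b\<close> then \<open>F 0 + F pi\<close> is an integer
  that is positive and tends to 0 as \<open>n\<close> grows.\<close>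
theorem pi_irrational: "pi \<notin> \<rat>"
proof
  assume "pi \<in> \<rat>"
  then obtain a b :: int where "b > 0" and ab: "pi = real_of_int a / real_of_int b"
    by (meson Rats_cases')
  have bpi: "real_of_int a = real_of_int b * pi" unfolding ab using \<open>b > 0\<close> by simp
  have a0: "real_of_int a > 0" unfolding bpi using \<open>b > 0\<close> by simp
  \<comment> \<open>On \<open>[0, pi]\<close> the product \<open>x * (a - b * x)\<close> is at most
    \<open>pi * a\<close>. Hence \<open>c ^ n / n!\<close> will bound \<open>f\<close>; it tends to
    0 as a term of the exponential series.\<close>
  define c where "c = pi * real_of_int a"
  have "(\<lambda>n. pi * (c ^ n / fact n)) \<longlonglongrightarrow> pi * 0"
    by (intro tendsto_mult tendsto_const) (use summable_LIMSEQ_zero[OF summable_exp[of c]] in \<open>simp add: divide_inverse mult.commute\<close>)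
  then have "\<forall>\<^sub>F n in sequentially. pi * (c ^ n / fact n) < 1"
    by (intro order_tendstoD) auto
  then obtain n where n: "pi * (c ^ n / fact n) < 1"
    by (auto simp: eventually_sequentially)
  define g :: "real poly" where "g = [:real_of_int a, - real_of_int b:] ^ n"
  define f :: "real poly" where "f = smult (1 / fact n) (monom 1 n * g)"
  define F :: "real poly" where "F = (\<Sum>i\<le>n. smult ((-1) ^ i) ((pderiv ^^ (2 * i)) f))"
  have poly_f: "poly f x = x ^ n * (real_of_int a - real_of_int b * x) ^ n / fact n" for x
    by (simp add: f_def g_def poly_monom algebra_simps)
  have "degree f \<le> n + n"
  proof -
    have "degree [:real_of_int a, - real_of_int b:] = 1"
      using \<open>b > 0\<close> by simp
    then have "degree g \<le> n"
      unfolding g_def using degree_power_le[of "[:real_of_int a, - real_of_int b:]" n] by simp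
    then show ?thesis
      unfolding f_def
      using degree_mult_le[of "monom (1::real) n" g] degree_monom_le[of "1::real" n]
      by (simp add: degree_smult_le)
  qed
  \<comment> \<open>The degree is at most \<open>2 * n\<close>, so the derivative of order
    \<open>2 * n + 2\<close> vanishes. It is the far end of the telescoping sum below, which
    therefore leaves only \<open>f\<close>.\<close>
  then have f_high: "(pderiv ^^ (2 * Suc n)) f = 0"
    by (intro poly_eqI) (simp only: coeff_higher_pderiv, simp add: coeff_eq_0)
  have FF: "pderiv (pderiv F) + F = f"
  proof -
    have "pderiv (pderiv F) = (\<Sum>i\<le>n. smult ((-1) ^ i) ((pderiv ^^ (2 * Suc i)) f))"
      using higher_pderiv_sum[of 2 "\<lambda>i. smult ((-1) ^ i) ((pderiv ^^ (2 * i)) f)" "{..n}"]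
      by (simp add: F_def pderiv_smult numeral_2_eq_2)
    then have "pderiv (pderiv F) + F = (\<Sum>i\<le>n. smult ((-1) ^ i) ((pderiv ^^ (2 * i)) f)
        - smult ((-1) ^ Suc i) ((pderiv ^^ (2 * Suc i)) f))"
      by (simp add: F_def sum.distrib)
    also have "\<dots> = f"
      using f_high by (subst sum_telescope) simp
    finally show ?thesis .
  qed
  define G where "G = (\<lambda>x. poly (pderiv F) x * sin x - poly F x * cos x)"
  have G': "(G has_real_derivative poly f x * sin x) (at x)" for x
  proof -
    have "poly f x = poly (pderiv (pderiv F)) x + poly F x"
      by (metis FF poly_add)
    then show ?thesis
      unfolding G_def
      by (auto intro!: derivative_eq_intros simp: algebra_simps)
  qed
  obtain \<xi> where \<xi>: "0 < \<xi>" "\<xi> < pi" and GG: "G pi - G 0 = (pi - 0) * (poly f \<xi> * sin \<xi>)"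
    using MVT2[of 0 pi G "\<lambda>x. poly f x * sin x"] G' pi_gt_zero by blast
  \<comment> \<open>The \<open>k\<close>-th derivative at 0 is \<open>k!\<close> times the
    coefficient of \<open>x ^ k\<close>. That coefficient is 0 for \<open>k < n\<close> because of
    the factor \<open>x ^ n\<close>, and for \<open>k >= n\<close> the factorial absorbs the
    denominator \<open>n!\<close>.\<close>
  have Fint: "poly ((pderiv ^^ k) f) 0 \<in> \<int>" for k
  proof -
    have "coeff g i \<in> \<int>" for i
      unfolding g_def by (rule Ints_coeff_power) (auto simp: coeff_pCons split: nat.splits)
    moreover have "\<exists>j. (fact k :: real) = fact n * of_int j" if "n \<le> k"
      using fact_dvd[OF that, where 'a=int] by (metis dvdE of_int_fact of_int_mult)
    ultimately have "fact k * coeff f k \<in> \<int>"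
      by (fastforce simp: f_def coeff_monom_mult not_less)
    then show ?thesis
      by (simp add: poly_0_coeff_0 coeff_higher_pderiv pochhammer_fact)
  qed
  \<comment> \<open>Since \<open>a = b * pi\<close>, the second factor is
    \<open>b * (pi - x)\<close>, so reflection at \<open>pi / 2\<close> merely swaps the roles of
    the two factors.\<close>
  have "pcompose f [:pi, -1:] = f"
  proof (rule poly_ext)
    fix x
    have "real_of_int a - real_of_int b * (pi - x) = real_of_int b * x"
         "real_of_int a - real_of_int b * x = real_of_int b * (pi - x)"
      by (simp_all add: bpi algebra_simps)
    note reflect = this
    have "poly (pcompose f [:pi, -1:]) x = poly f (pi - x)" by (simp add: poly_pcompose)
    then show "poly (pcompose f [:pi, -1:]) x = poly f x"
      unfolding poly_f reflect by (simp add: power_mult_distrib)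
  qed
  from higher_pderiv_reflect[OF this, of _ 0]
  have "poly ((pderiv ^^ (2 * i)) f) pi = poly ((pderiv ^^ (2 * i)) f) 0" for i by simp
  then have "poly F pi + poly F 0 \<in> \<int>"
    using Fint by (auto simp: F_def poly_sum intro!: Ints_add Ints_sum Ints_mult)
  then have "G pi - G 0 \<in> \<int>" by (simp add: G_def)
  moreover have "0 < G pi - G 0"
  proof -
    have "real_of_int a - real_of_int b * \<xi> > 0"
      using \<xi> \<open>b > 0\<close> by (simp add: bpi)
    then show ?thesis using \<xi> unfolding GG by (simp add: poly_f sin_gt_zero)
  qed
  moreover have "G pi - G 0 < 1"
  proof -
    have le: "0 \<le> real_of_int a - real_of_int b * \<xi>" "real_of_int a - real_of_int b * \<xi> \<le> real_of_int a"
      using \<xi> \<open>b > 0\<close> by (simp_all add: bpi)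
    have "\<xi> ^ n * (real_of_int a - real_of_int b * \<xi>) ^ n \<le> pi ^ n * real_of_int a ^ n"
      using \<xi> le a0 by (intro mult_mono power_mono) auto
    then have "poly f \<xi> \<le> c ^ n / fact n"
      by (simp add: poly_f c_def power_mult_distrib divide_right_mono)
    moreover have "0 \<le> poly f \<xi>" using \<xi> le by (simp add: poly_f)
    ultimately have "poly f \<xi> * sin \<xi> \<le> c ^ n / fact n"
      by (meson mult_left_le order_trans sin_le_one)
    moreover have "0 \<le> poly f \<xi> * sin \<xi>"
      using \<open>0 \<le> poly f \<xi>\<close> \<xi> by (simp add: sin_ge_zero)
    ultimately have "G pi - G 0 \<le> pi * (c ^ n / fact n)"
      unfolding GG by (intro mult_mono) auto
    then show ?thesis using n by linarith
  qed
  ultimately show False by (auto elim!: Ints_cases)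
qed

section \<open>Frequencies and equidistribution\<close>

text \<open>The finitely many exceptional \<open>k\<close> change a count by at most a constant,
  which disappears after division by \<open>n\<close>.\<close>

lemma card_filter_le_eventually:
  fixes P Q :: "nat \<Rightarrow> bool"
  assumes "\<forall>\<^sub>F k in sequentially. P k \<longrightarrow> Q k"
  obtains C where "\<And>n. card {k \<in> {1..n}. P k} \<le> card {k \<in> {1..n}. Q k} + C"
proof -
  obtain N where N: "\<And>k. k \<ge> N \<Longrightarrow> P k \<Longrightarrow> Q k"
    using assms by (auto simp: eventually_sequentially)
  have "card {k \<in> {1..n}. P k} \<le> card {k \<in> {1..n}. Q k} + N" for n
  proof -
    have "{k \<in> {1..n}. P k} \<subseteq> {k \<in> {1..n}. Q k} \<union> {..<N}"
      using N by (auto simp: not_less)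
    then have "card {k \<in> {1..n}. P k} \<le> card ({k \<in> {1..n}. Q k} \<union> {..<N})"
      by (intro card_mono) auto
    also have "\<dots> \<le> card {k \<in> {1..n}. Q k} + card {..<N}"
      by (rule card_Un_le)
    finally show ?thesis by simp
  qed
  then show ?thesis by (rule that)
qed

lemma frequency_cong:
  fixes P Q :: "nat \<Rightarrow> bool"
  assumes "\<forall>\<^sub>F k in sequentially. P k \<longleftrightarrow> Q k"
    and "(\<lambda>n. real (card {k \<in> {1..n}. Q k}) / real n) \<longlonglongrightarrow> c"
  shows "(\<lambda>n. real (card {k \<in> {1..n}. P k}) / real n) \<longlonglongrightarrow> c"
proof -
  have PQ: "\<forall>\<^sub>F k in sequentially. P k \<longrightarrow> Q k" and QP: "\<forall>\<^sub>F k in sequentially. Q k \<longrightarrow> P k"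
    using assms(1) by (auto elim: eventually_mono)
  obtain C where C: "\<And>n. card {k \<in> {1..n}. P k} \<le> card {k \<in> {1..n}. Q k} + C"
    by (rule card_filter_le_eventually[OF PQ]) blast
  obtain D where D: "\<And>n. card {k \<in> {1..n}. Q k} \<le> card {k \<in> {1..n}. P k} + D"
    by (rule card_filter_le_eventually[OF QP]) blast
  show ?thesis
  proof (rule tendsto_sandwich)
    show "(\<lambda>n. real (card {k \<in> {1..n}. Q k}) / real n - real D / real n) \<longlonglongrightarrow> c"
      using tendsto_diff[OF assms(2) lim_const_over_n[of "real D"]] by simp
    show "(\<lambda>n. real (card {k \<in> {1..n}. Q k}) / real n + real C / real n) \<longlonglongrightarrow> c"
      using tendsto_add[OF assms(2) lim_const_over_n[of "real C"]] by simp
    show "\<forall>\<^sub>F n in sequentially. real (card {k \<in> {1..n}. Q k}) / real n - real D / real n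
        \<le> real (card {k \<in> {1..n}. P k}) / real n"
      unfolding diff_divide_distrib[symmetric]
      by (intro always_eventually allI divide_right_mono) (use D in \<open>simp_all add: algebra_simps flip: of_nat_add\<close>)
    show "\<forall>\<^sub>F n in sequentially. real (card {k \<in> {1..n}. P k}) / real n
        \<le> real (card {k \<in> {1..n}. Q k}) / real n + real C / real n"
      unfolding add_divide_distrib[symmetric]
      by (intro always_eventually allI divide_right_mono) (use C in \<open>simp_all flip: of_nat_add\<close>)
  qed
qed

text \<open>For a bound \<open>a\<close> on either side of \<open>c\<close>, an arc ending halfway
  between \<open>a\<close> and \<open>c\<close> separates them: its frequency is known, and
  \<open>P\<close> is eventually comparable with it. All later frequencies are obtained from such
  approximate comparisons.\<close>

lemma frequency_tendsto_sandwich: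
  fixes x :: "nat \<Rightarrow> real"
  assumes equi: "equidistributed x" and c: "0 \<le> c" "c \<le> 1"
    and lower: "\<And>e. e > 0 \<Longrightarrow> \<forall>\<^sub>F k in sequentially. frac (x k) \<le> c - e \<longrightarrow> P k"
    and upper: "\<And>e. e > 0 \<Longrightarrow> \<forall>\<^sub>F k in sequentially. P k \<longrightarrow> frac (x k) \<le> c + e"
  shows "(\<lambda>n. real (card {k \<in> {1..n}. P k}) / real n) \<longlonglongrightarrow> c"
proof (rule order_tendstoI)
  fix a assume a: "a < c"
  show "\<forall>\<^sub>F n in sequentially. a < real (card {k \<in> {1..n}. P k}) / real n"
  proof (cases "a < 0")
    case True
    then show ?thesis
      by (intro always_eventually allI less_le_trans[OF True]) simp
  next
    case False
    define b where "b = (a + c) / 2"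
    have b: "0 \<le> b" "b \<le> 1" "a < b" using a False c by (auto simp: b_def)
    have "\<forall>\<^sub>F k in sequentially. frac (x k) \<le> b \<longrightarrow> P k"
      using lower[of "c - b"] a by (simp add: b_def field_simps)
    then obtain C where C: "\<And>n. card {k \<in> {1..n}. frac (x k) \<le> b} \<le> card {k \<in> {1..n}. P k} + C"
      by (rule card_filter_le_eventually) blast
    have "(\<lambda>n. real (card {k \<in> {1..n}. frac (x k) \<le> b}) / real n) \<longlonglongrightarrow> b"
      using equi b unfolding equidistributed_def by simp
    from tendsto_diff[OF this lim_const_over_n[of "real C"]]
    have "\<forall>\<^sub>F n in sequentially. a < real (card {k \<in> {1..n}. frac (x k) \<le> b}) / real n - real C / real n"
      by (rule order_tendstoD) (use b in simp)
    then show ?thesis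
    proof eventually_elim
      case (elim n)
      have "(real (card {k \<in> {1..n}. frac (x k) \<le> b}) - real C) / real n \<le> real (card {k \<in> {1..n}. P k}) / real n"
        using C[of n] by (intro divide_right_mono) auto
      then show ?case using elim by (simp add: diff_divide_distrib)
    qed
  qed
next
  fix a assume a: "c < a"
  \<comment> \<open>Equidistribution speaks only of arcs ending in \<open>[0, 1]\<close>. When the
    cap at 1 is active, the required bound on \<open>frac\<close> is automatic.\<close>
  define b where "b = min 1 ((a + c) / 2)"
  have b: "0 \<le> b" "b \<le> 1" "b < a" using a c by (auto simp: b_def min_less_iff_disj)
  have "\<forall>\<^sub>F k in sequentially. P k \<longrightarrow> frac (x k) \<le> b"
    using upper[of "(a - c) / 2"] a
    by (auto elim!: eventually_mono simp: b_def field_simps less_imp_le[OF frac_lt_1])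
  then obtain C where C: "\<And>n. card {k \<in> {1..n}. P k} \<le> card {k \<in> {1..n}. frac (x k) \<le> b} + C"
    by (rule card_filter_le_eventually) blast
  have "(\<lambda>n. real (card {k \<in> {1..n}. frac (x k) \<le> b}) / real n) \<longlonglongrightarrow> b"
    using equi b unfolding equidistributed_def by simp
  from tendsto_add[OF this lim_const_over_n[of "real C"]]
  have "\<forall>\<^sub>F n in sequentially. real (card {k \<in> {1..n}. frac (x k) \<le> b}) / real n + real C / real n < a"
    by (rule order_tendstoD) (use b in simp)
  then show "\<forall>\<^sub>F n in sequentially. real (card {k \<in> {1..n}. P k}) / real n < a"
  proof eventually_elim
    case (elim n)
    have "real (card {k \<in> {1..n}. P k}) / real n \<le> (real (card {k \<in> {1..n}. frac (x k) \<le> b}) + real C) / real n"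
      using C[of n] by (intro divide_right_mono) auto
    then show ?case using elim by (simp add: add_divide_distrib)
  qed
qed

section \<open>Equidistribution of irrational rotations\<close>

text \<open>Rotation by \<open>q * \<alpha>\<close> shifts arcs by the small step \<open>\<delta>\<close>, so consecutive arcs of length \<open>\<delta>\<close>
  are visited equally often up to a bounded error.\<close>
context
  fixes \<alpha> :: real and q :: nat and \<delta> :: real
  defines "\<delta> \<equiv> frac (real q * \<alpha>)"
begin

lemma frac_rotation_add:
  assumes "frac (real k * \<alpha>) + real j * \<delta> < 1"
  shows "frac (real (k + j * q) * \<alpha>) = frac (real k * \<alpha>) + real j * \<delta>"
proof -
  have "real (k + j * q) * \<alpha> - (frac (real k * \<alpha>) + real j * \<delta>)
      = of_int (\<lfloor>real k * \<alpha>\<rfloor> + int j * \<lfloor>real q * \<alpha>\<rfloor>)"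
    by (simp add: \<delta>_def frac_def algebra_simps)
  also have "\<dots> \<in> \<int>" by (rule Ints_of_int)
  finally show ?thesis
    using assms by (simp add: frac_unique_iff \<delta>_def)
qed

lemma frac_rotation_diff:
  assumes "j * q \<le> k" "real j * \<delta> \<le> frac (real k * \<alpha>)"
  shows "frac (real (k - j * q) * \<alpha>) = frac (real k * \<alpha>) - real j * \<delta>"
proof -
  have "real (k - j * q) * \<alpha> - (frac (real k * \<alpha>) - real j * \<delta>)
      = of_int (\<lfloor>real k * \<alpha>\<rfloor> - int j * \<lfloor>real q * \<alpha>\<rfloor>)"
    using assms(1) by (simp add: \<delta>_def frac_def algebra_simps of_nat_diff)
  also have "\<dots> \<in> \<int>" by (rule Ints_of_int)
  moreover have "frac (real k * \<alpha>) - real j * \<delta> < 1"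
    using frac_lt_1[of "real k * \<alpha>"] by (smt (verit) \<delta>_def frac_ge_0 mult_nonneg_nonneg of_nat_0_le_iff)
  ultimately show ?thesis
    using assms by (simp add: frac_unique_iff)
qed

text \<open>Subtracting \<open>j * q\<close> from the index moves arc \<open>j\<close> back onto the
  first arc. Indices up to \<open>j * q\<close> cannot be moved back and form the error
  term.\<close>

lemma card_arc_le:
  "card {k \<in> {1..n}. real j * \<delta> \<le> frac (real k * \<alpha>) \<and> frac (real k * \<alpha>) < real (Suc j) * \<delta>}
     \<le> card {k \<in> {1..n}. frac (real k * \<alpha>) < \<delta>} + j * q"
proof -
  let ?A = "{k \<in> {1..n}. real j * \<delta> \<le> frac (real k * \<alpha>) \<and> frac (real k * \<alpha>) < real (Suc j) * \<delta>}"
  let ?B = "{k \<in> {1..n}. frac (real k * \<alpha>) < \<delta>}"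
  have "?A \<subseteq> (\<lambda>k. k + j * q) ` ?B \<union> {1..j * q}"
  proof
    fix k assume k: "k \<in> ?A"
    show "k \<in> (\<lambda>k. k + j * q) ` ?B \<union> {1..j * q}"
    proof (cases "k \<le> j * q")
      case False
      then have "frac (real (k - j * q) * \<alpha>) < \<delta>"
        using k by (subst frac_rotation_diff) (auto simp: algebra_simps)
      then have "k - j * q \<in> ?B" using False k by auto
      then show ?thesis using False by (intro UnI1 image_eqI[of _ _ "k - j * q"]) auto
    qed (use k in auto)
  qed
  then have "card ?A \<le> card ((\<lambda>k. k + j * q) ` ?B \<union> {1..j * q})"
    by (intro card_mono) auto
  also have "\<dots> \<le> card ((\<lambda>k. k + j * q) ` ?B) + card {1..j * q}" by (rule card_Un_le)
  also have "\<dots> \<le> card ?B + j * q" by (simp add: card_image_le)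
  finally show ?thesis .
qed

text \<open>Adding \<open>j * q\<close> to the index moves the first arc onto arc \<open>j\<close>;
  the hypothesis rules out wrapping around 1. The error counts the last \<open>j * q\<close>
  indices, which would leave \<open>{1..n}\<close>.\<close>

lemma card_arc_ge:
  assumes "real (Suc j) * \<delta> \<le> 1"
  shows "card {k \<in> {1..n}. frac (real k * \<alpha>) < \<delta>}
     \<le> card {k \<in> {1..n}. real j * \<delta> \<le> frac (real k * \<alpha>) \<and> frac (real k * \<alpha>) < real (Suc j) * \<delta>} + j * q"
proof -
  let ?A = "{k \<in> {1..n}. real j * \<delta> \<le> frac (real k * \<alpha>) \<and> frac (real k * \<alpha>) < real (Suc j) * \<delta>}"
  let ?B = "{k \<in> {1..n}. frac (real k * \<alpha>) < \<delta>}"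
  let ?C = "{k \<in> {1..n}. k + j * q \<le> n \<and> frac (real k * \<alpha>) < \<delta>}"
  have "(\<lambda>k. k + j * q) ` ?C \<subseteq> ?A"
  proof
    fix l assume "l \<in> (\<lambda>k. k + j * q) ` ?C"
    then obtain k where k: "l = k + j * q" "k \<in> ?C" by blast
    then have "frac (real l * \<alpha>) = frac (real k * \<alpha>) + real j * \<delta>"
      using assms unfolding k(1) by (intro frac_rotation_add) (auto simp: algebra_simps)
    then show "l \<in> ?A" using k by (auto simp: algebra_simps)
  qed
  then have "card ((\<lambda>k. k + j * q) ` ?C) \<le> card ?A" by (intro card_mono) auto
  then have C: "card ?C \<le> card ?A" by (subst (asm) card_image) (auto simp: inj_on_def)
  have "?B \<subseteq> ?C \<union> {n - j * q<..n}" by auto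
  then have "card ?B \<le> card (?C \<union> {n - j * q<..n})" by (intro card_mono) auto
  also have "\<dots> \<le> card ?C + card {n - j * q<..n}" by (rule card_Un_le)
  also have "\<dots> \<le> card ?A + j * q" using C by simp
  finally show ?thesis .
qed

lemma card_initial_segment_Suc:
  assumes "0 \<le> \<delta>"
  shows "card {k \<in> {1..n}. frac (real k * \<alpha>) < real (Suc L) * \<delta>} =
    card {k \<in> {1..n}. frac (real k * \<alpha>) < real L * \<delta>} +
    card {k \<in> {1..n}. real L * \<delta> \<le> frac (real k * \<alpha>) \<and> frac (real k * \<alpha>) < real (Suc L) * \<delta>}"
proof -
  have "{k \<in> {1..n}. frac (real k * \<alpha>) < real (Suc L) * \<delta>} =
    {k \<in> {1..n}. frac (real k * \<alpha>) < real L * \<delta>} \<union>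
    {k \<in> {1..n}. real L * \<delta> \<le> frac (real k * \<alpha>) \<and> frac (real k * \<alpha>) < real (Suc L) * \<delta>}"
    using assms by (auto simp: algebra_simps)
  then show ?thesis by (simp only:) (rule card_Un_disjoint, auto)
qed

text \<open>The segment is the union of the arcs \<open>0, ..., L - 1\<close>, each of which costs
  an error of at most \<open>L * q\<close>.\<close>

lemma card_initial_segment_le:
  "card {k \<in> {1..n}. frac (real k * \<alpha>) < real L * \<delta>}
     \<le> L * card {k \<in> {1..n}. frac (real k * \<alpha>) < \<delta>} + L * L * q"
proof (induction L)
  case 0
  have "\<not> frac x < 0" for x :: real by (simp add: not_less)
  then show ?case by simp
next
  case (Suc L)
  have d: "0 \<le> \<delta>" by (simp add: \<delta>_def)
  show ?case
    unfolding card_initial_segment_Suc[OF d]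
    using Suc card_arc_le[of n L] by (simp add: algebra_simps)
qed

lemma card_initial_segment_ge:
  assumes "real L * \<delta> \<le> 1"
  shows "L * card {k \<in> {1..n}. frac (real k * \<alpha>) < \<delta>}
     \<le> card {k \<in> {1..n}. frac (real k * \<alpha>) < real L * \<delta>} + L * L * q"
  using assms
proof (induction L)
  case (Suc L)
  have d: "0 \<le> \<delta>" by (simp add: \<delta>_def)
  then have "real L * \<delta> \<le> 1" using Suc.prems by (simp add: algebra_simps)
  then show ?case
    unfolding card_initial_segment_Suc[OF d]
    using Suc.IH card_arc_ge[OF Suc.prems, of n] by (simp add: algebra_simps)
qed simp

text \<open>Let \<open>A\<close> count the visits to the first arc. About
  \<open>1 / \<delta>\<close> arcs fill the unit interval, so \<open>n\<close> is about
  \<open>A / \<delta>\<close>, and about \<open>\<beta> / \<delta>\<close> arcs fill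
  \<open>[0, \<beta>]\<close>. Eliminating \<open>A\<close> leaves rounding errors proportional to
  \<open>\<delta>\<close> and bounded boundary terms, collected in \<open>C\<close>.\<close>

lemma frequency_rotation_bounds:
  assumes d: "0 < \<delta>" "\<delta> < 1 / 2" and b: "0 \<le> \<beta>" "\<beta> \<le> 1"
  obtains C :: real where
    "\<And>n. n > 0 \<Longrightarrow> real (card {k \<in> {1..n}. frac (real k * \<alpha>) \<le> \<beta>}) / real n \<le> \<beta> + 4 * \<delta> + C / real n"
    "\<And>n. n > 0 \<Longrightarrow> \<beta> - 2 * \<delta> - C / real n \<le> real (card {k \<in> {1..n}. frac (real k * \<alpha>) \<le> \<beta>}) / real n"
proof -
  define L where "L = nat \<lfloor>\<beta> / \<delta>\<rfloor>"
  define J where "J = nat \<lfloor>1 / \<delta>\<rfloor>"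
  have L: "real L \<le> \<beta> / \<delta>" "\<beta> / \<delta> < real L + 1"
    using b d by (auto simp: L_def)
  have J: "real J \<le> 1 / \<delta>" "1 / \<delta> < real J + 1"
    using d by (auto simp: J_def)
  have L': "real L * \<delta> \<le> \<beta>" "\<beta> < real (Suc L) * \<delta>"
    using L d by (auto simp: field_simps)
  have J': "real J * \<delta> \<le> 1" "1 < real (Suc J) * \<delta>"
    using J d by (auto simp: field_simps)
  have J0: "real J > 0" using J' d by (cases J) auto
  define D where "D = real (Suc J * Suc J * q + Suc L * Suc L * q)"
  define C where "C = 4 * D"
  have D0: "0 \<le> D" by (simp add: D_def)
  have both: "real (card {k \<in> {1..n}. frac (real k * \<alpha>) \<le> \<beta>}) \<le> (\<beta> + 4 * \<delta>) * real n + C"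
       "(\<beta> - 2 * \<delta>) * real n - C \<le> real (card {k \<in> {1..n}. frac (real k * \<alpha>) \<le> \<beta>})" for n
  proof -
    define A where "A = real (card {k \<in> {1..n}. frac (real k * \<alpha>) < \<delta>})"
    define B where "B = (\<lambda>L. real (card {k \<in> {1..n}. frac (real k * \<alpha>) < real L * \<delta>}))"
    define N where "N = real (card {k \<in> {1..n}. frac (real k * \<alpha>) \<le> \<beta>})"
    have up: "B M \<le> real M * A + real (M * M * q)" for M
      using card_initial_segment_le[of n M] unfolding A_def B_def
      by (simp only: of_nat_mult[symmetric] of_nat_add[symmetric] of_nat_le_iff)
    have dn: "real M * A \<le> B M + real (M * M * q)" if "real M * \<delta> \<le> 1" for M
      using card_initial_segment_ge[OF that, of n] unfolding A_def B_def
      by (simp only: of_nat_mult[symmetric] of_nat_add[symmetric] of_nat_le_iff)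
    have "{k \<in> {1..n}. frac (real k * \<alpha>) < real J * \<delta>} \<subseteq> {1..n}" by auto
    from card_mono[OF _ this] have "B J \<le> real n" unfolding B_def by simp
    moreover have "real (J * J * q) \<le> D" "real (L * L * q) \<le> D" "real (Suc J * Suc J * q) \<le> D" "real (Suc L * Suc L * q) \<le> D"
      unfolding D_def of_nat_le_iff by (simp_all add: algebra_simps)
    note D = this
    ultimately have JA: "real J * A \<le> real n + D" using dn[OF J'(1)] by linarith
    \<comment> \<open>\<open>J\<close> arcs still fit into the unit interval, whereas
      \<open>J + 1\<close> arcs cover it. This brackets \<open>n\<close> between multiples of
      \<open>A\<close>.\<close>
    have "{k \<in> {1..n}. frac (real k * \<alpha>) < real (Suc J) * \<delta>} = {1..n}"
      using J'(2) frac_lt_1 by (auto intro: less_trans)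
    then have "B (Suc J) = real n" unfolding B_def by simp
    then have JA': "real n \<le> real (Suc J) * A + D" using up[of "Suc J"] D by linarith
    have "N \<le> B (Suc L)"
      unfolding N_def B_def of_nat_le_iff using L'(2) by (intro card_mono) (auto simp del: of_nat_Suc)
    then have N1: "N \<le> real (Suc L) * A + D" using up[of "Suc L"] D by linarith
    have "B L \<le> N"
      unfolding N_def B_def of_nat_le_iff using L'(1) by (intro card_mono) auto
    moreover have "real L * \<delta> \<le> 1" using L' b by linarith
    ultimately have N2: "real L * A \<le> N + D" using dn[of L] D by linarith
    \<comment> \<open>The coefficients 4 here and 2 in \<open>c2\<close> leave room for rounding
      both \<open>L\<close> and \<open>J\<close>: the inequalities reduce to
      \<open>\<delta> * (\<beta> + 4 * \<delta>) \<le> 3 * \<delta>\<close> and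
      \<open>\<delta> * (\<beta> - 2 * \<delta>) \<le> \<delta>\<close>.\<close>
    have c1: "real (Suc L) \<le> (\<beta> + 4 * \<delta>) * real J"
    proof -
      have "real (Suc L) * \<delta> \<le> \<beta> + \<delta>" using L' by (simp add: algebra_simps)
      also have "\<dots> \<le> (\<beta> + 4 * \<delta>) * (1 - \<delta>)"
      proof -
        have "\<delta> * (\<beta> + 4 * \<delta>) \<le> \<delta> * 3" using d b by (intro mult_left_mono) auto
        then show ?thesis by (simp add: algebra_simps)
      qed
      also have "\<dots> \<le> (\<beta> + 4 * \<delta>) * (real J * \<delta>)"
        using J' d b by (intro mult_left_mono) (auto simp: algebra_simps)
      finally show ?thesis using d by (simp add: mult.assoc[symmetric])
    qed
    have c2: "(\<beta> - 2 * \<delta>) * real (Suc J) \<le> real L"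
    proof (cases "\<beta> - 2 * \<delta> \<le> 0")
      case True
      then have "(\<beta> - 2 * \<delta>) * real (Suc J) \<le> 0" by (intro mult_nonpos_nonneg) auto
      then show ?thesis by (meson of_nat_0_le_iff order_trans)
    next
      case False
      have "(\<beta> - 2 * \<delta>) * (real (Suc J) * \<delta>) \<le> (\<beta> - 2 * \<delta>) * (1 + \<delta>)"
        using False J' by (intro mult_left_mono) (auto simp: algebra_simps)
      also have "\<dots> \<le> \<beta> - \<delta>"
      proof -
        have "\<delta> * (\<beta> - 2 * \<delta>) \<le> \<delta> * 1" using d b by (intro mult_left_mono) auto
        then show ?thesis by (simp add: algebra_simps)
      qed
      also have "\<dots> \<le> real L * \<delta>" using L' by (simp add: algebra_simps)
      finally show ?thesis using d by (simp add: mult.assoc[symmetric] del: of_nat_Suc)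
    qed
    have A0: "0 \<le> A" by (simp add: A_def)
    have "real (Suc L) * A \<le> (\<beta> + 4 * \<delta>) * real J * A" using c1 A0 by (intro mult_right_mono)
    also have "\<dots> \<le> (\<beta> + 4 * \<delta>) * (real n + D)"
      using JA b d by (subst mult.assoc) (intro mult_left_mono, auto)
    also have "\<dots> \<le> (\<beta> + 4 * \<delta>) * real n + 3 * D"
    proof -
      have "(\<beta> + 4 * \<delta>) * D \<le> 3 * D" using d b D0 by (intro mult_right_mono) auto
      then show ?thesis by (simp add: algebra_simps)
    qed
    finally show "real (card {k \<in> {1..n}. frac (real k * \<alpha>) \<le> \<beta>}) \<le> (\<beta> + 4 * \<delta>) * real n + C"
      using N1 unfolding N_def[symmetric] C_def by linarith
    have "(\<beta> - 2 * \<delta>) * real n \<le> N + 4 * D"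
    proof (cases "\<beta> - 2 * \<delta> \<le> 0")
      case True
      then have "(\<beta> - 2 * \<delta>) * real n \<le> 0" by (intro mult_nonpos_nonneg) auto
      moreover have "0 \<le> N" by (simp add: N_def)
      ultimately show ?thesis using D0 by linarith
    next
      case False
      have "(\<beta> - 2 * \<delta>) * real n \<le> (\<beta> - 2 * \<delta>) * (real (Suc J) * A + D)"
        using False JA' by (intro mult_left_mono) auto
      also have "\<dots> = (\<beta> - 2 * \<delta>) * real (Suc J) * A + (\<beta> - 2 * \<delta>) * D"
        by (simp only: distrib_left mult.assoc)
      also have "\<dots> \<le> real L * A + 1 * D"
        using c2 A0 D0 d b by (intro add_mono mult_right_mono) auto
      finally show ?thesis using N2 D0 by linarith
    qed
    then show "(\<beta> - 2 * \<delta>) * real n - C \<le> real (card {k \<in> {1..n}. frac (real k * \<alpha>) \<le> \<beta>})"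
      unfolding N_def[symmetric] C_def by linarith
  qed
  show thesis
  proof (rule that[of C])
    fix n :: nat assume "n > 0"
    then have "\<beta> + 4 * \<delta> + C / real n = ((\<beta> + 4 * \<delta>) * real n + C) / real n"
      "\<beta> - 2 * \<delta> - C / real n = ((\<beta> - 2 * \<delta>) * real n - C) / real n"
      by (simp_all add: add_divide_distrib diff_divide_distrib)
    then show "real (card {k \<in> {1..n}. frac (real k * \<alpha>) \<le> \<beta>}) / real n \<le> \<beta> + 4 * \<delta> + C / real n"
      "\<beta> - 2 * \<delta> - C / real n \<le> real (card {k \<in> {1..n}. frac (real k * \<alpha>) \<le> \<beta>}) / real n"
      using both[of n] by (auto simp only: intro!: divide_right_mono)
  qed
qed

end

text \<open>By Kronecker's theorem some \<open>q * \<alpha>\<close> has a positive fractional part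
  as small as desired. Taken as the step in the rotation bounds, it forces the frequency towards
  \<open>\<beta>\<close>.\<close>

theorem equidistributed_mult_irrational:
  assumes "\<alpha> \<notin> \<rat>"
  shows "equidistributed (\<lambda>n. real n * \<alpha>)"
  unfolding equidistributed_def
proof
  fix \<beta> :: real assume "\<beta> \<in> {0..1}"
  then have b: "0 \<le> \<beta>" "\<beta> \<le> 1" by auto
  have "\<forall>\<^sub>F n in sequentially. \<bar>real (card {k \<in> {1..n}. frac (real k * \<alpha>) \<le> \<beta>}) / real n - \<beta>\<bar> < e"
    if "e > 0" for e :: real
  proof -
    \<comment> \<open>Centre and radius \<open>d / 2\<close> put the step into the open interval
      from 0 to \<open>d\<close>. The bound \<open>e / 8\<close> keeps four steps below
      \<open>e / 2\<close>, and the other half of \<open>e\<close> pays for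
      \<open>C / n\<close>.\<close>
    define d where "d = min (1 / 2) (e / 8)"
    have d: "0 < d" using that by (simp add: d_def)
    have d1: "d / 2 \<le> 1" by (simp add: d_def)
    obtain q where q: "\<bar>frac (real q * \<alpha>) - d / 2\<bar> < d / 2"
      using Kronecker_approx_1_explicit[OF assms, of "d / 2" "d / 2"] d d1 by auto
    then have q': "0 < frac (real q * \<alpha>)" "frac (real q * \<alpha>) < 1 / 2" "frac (real q * \<alpha>) < e / 8"
      unfolding d_def by linarith+
    obtain C where C:
      "\<And>n. n > 0 \<Longrightarrow> real (card {k \<in> {1..n}. frac (real k * \<alpha>) \<le> \<beta>}) / real n \<le> \<beta> + 4 * frac (real q * \<alpha>) + C / real n"
      "\<And>n. n > 0 \<Longrightarrow> \<beta> - 2 * frac (real q * \<alpha>) - C / real n \<le> real (card {k \<in> {1..n}. frac (real k * \<alpha>) \<le> \<beta>}) / real n"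
      using frequency_rotation_bounds[OF q'(1,2) b] by blast
    have "\<forall>\<^sub>F n in sequentially. C / real n < e / 2"
      using lim_const_over_n[of C] that by (intro order_tendstoD) auto
    then show ?thesis
      using eventually_gt_at_top[of 0]
    proof eventually_elim
      case (elim n)
      then show ?case using C[of n] q' that unfolding abs_less_iff by linarith
    qed
  qed
  then show "(\<lambda>n. real (card {k \<in> {1..n}. frac (real k * \<alpha>) \<le> \<beta>}) / real n) \<longlonglongrightarrow> \<beta>"
    by (intro tendstoI) (simp add: dist_real_def)
qed

section \<open>Zeckendorf words\<close>

lemma FF_pos [simp]: "FF n > 0"
  by (induction n rule: FF.induct) auto

lemma FF_Suc_le: "FF n \<le> FF (Suc n)"
  by (cases n) auto

lemma FF_mono: "m \<le> n \<Longrightarrow> FF m \<le> FF n"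
  by (rule lift_Suc_mono_le[of FF]) (auto intro: FF_Suc_le)

lemma FF_less_Suc: "n \<ge> 1 \<Longrightarrow> FF n < FF (Suc n)"
  by (cases n) auto

lemma FF_ge_self: "n \<le> FF n"
proof (induction n rule: FF.induct)
  case (3 n)
  then show ?case using FF_pos[of n] by (cases n) auto
qed auto

lemma dotF_lessThan: "dotF b = (\<Sum>k<length b. b ! k * FF (length b - k))"
  unfolding dotF_def
  by (rule sum.reindex_bij_witness[of _ Suc "\<lambda>k. k - 1"]) (auto simp: Suc_diff_le)

lemma dotF_Nil [simp]: "dotF [] = 0"
  by (simp add: dotF_def)

lemma dotF_Cons [simp]: "dotF (x # xs) = x * FF (Suc (length xs)) + dotF xs"
  unfolding dotF_lessThan by (simp add: sum.lessThan_Suc_shift del: sum.lessThan_Suc)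

lemma dotF_append: "dotF (b @ e) = dotF (b @ replicate (length e) 0) + dotF e"
proof (induction b)
  case Nil
  have "dotF (replicate n 0) = 0" for n by (induction n) auto
  then show ?case by simp
qed simp

text \<open>Digits are listed from the most significant one. Leading zeros are allowed, so that
  tails of words are words and induction over lists applies; \<open>lead_word\<close> singles out
  the expansions of positive integers.\<close>

definition zeck_word :: "nat list \<Rightarrow> bool" where
  "zeck_word b \<longleftrightarrow> set b \<subseteq> {0, 1} \<and> successively (\<lambda>x y. x * y = 0) b"

definition lead_word :: "nat list \<Rightarrow> bool" where
  "lead_word b \<longleftrightarrow> zeck_word b \<and> b \<noteq> [] \<and> hd b = 1"

lemma zeck_word_Nil [simp]: "zeck_word []"
  by (simp add: zeck_word_def)

lemma zeck_word_Cons: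
  "zeck_word (x # xs) \<longleftrightarrow> (x = 0 \<or> x = 1 \<and> (xs = [] \<or> hd xs = 0)) \<and> zeck_word xs"
  by (cases xs) (auto simp: zeck_word_def)

lemma zeck_word_nth:
  "zeck_word b \<longleftrightarrow> (\<forall>k<length b. b ! k \<in> {0, 1}) \<and> (\<forall>k. Suc k < length b \<longrightarrow> b ! k * b ! Suc k = 0)"
  by (auto simp: zeck_word_def successively_conv_nth set_conv_nth)

lemma zeck_word_append1: "zeck_word (b @ e) \<Longrightarrow> zeck_word b"
  by (auto simp: zeck_word_def successively_append_iff)

text \<open>A leading 1 is followed by 0, so the rest is a word two places shorter, and the
  Fibonacci recursion adds its bound to the weight of the leading digit.\<close>

lemma zeck_word_less: "zeck_word b \<Longrightarrow> dotF b < FF (Suc (length b))"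
proof (induction b rule: induct_list012)
  case (3 x y zs)
  then show ?case using FF_Suc_le[of "length zs"] by (auto simp: zeck_word_Cons)
qed (auto simp: zeck_word_Cons)

lemma lead_word_ge: "lead_word b \<Longrightarrow> FF (length b) \<le> dotF b"
  by (cases b) (auto simp: lead_word_def)

text \<open>At the first differing digit the larger word has a 1, whose weight exceeds all that the
  remaining digits of the smaller one, including \<open>e\<close>, can add up to. So distinct
  leading blocks alone decide the order of integers with equally many digits.\<close>

lemma zeck_word_less_extend:
  assumes "zeck_word (b @ e)" "zeck_word b'" "length b = length b'" "dotF b < dotF b'"
  shows "dotF (b @ e) < dotF (b' @ replicate (length e) 0)"
  using assms(3,1,2,4)
proof (induction b b' rule: list_induct2)
  case (Cons x xs y ys)
  have x: "x = 0 \<or> x = 1" and y: "y = 0 \<or> y = 1"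
    and xs: "zeck_word (xs @ e)" and ys: "zeck_word ys"
    using Cons.prems by (auto simp: zeck_word_Cons)
  consider "x = y" | "x = 0" "y = 1" | "x = 1" "y = 0" using x y by auto
  then show ?case
  proof cases
    case 1
    then show ?thesis using Cons.IH[OF xs ys] Cons.prems Cons.hyps by simp
  next
    case 2
    then show ?thesis using zeck_word_less[OF xs] Cons.hyps by simp
  next
    case 3
    then show ?thesis using zeck_word_less[OF ys] Cons.prems Cons.hyps by simp
  qed
qed simp

lemma zeck_word_unique:
  assumes "length b = length b'" "zeck_word b" "zeck_word b'" "dotF b = dotF b'"
  shows "b = b'"
  using assms
proof (induction b b' rule: list_induct2)
  case (Cons x xs y ys)
  have "x = 0 \<or> x = 1" "y = 0 \<or> y = 1" "zeck_word xs" "zeck_word ys"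
    using Cons.prems by (auto simp: zeck_word_Cons)
  then show ?case
    using Cons zeck_word_less[of xs] zeck_word_less[of ys] by auto
qed simp

text \<open>Greedy choice: if the top weight \<open>FF n\<close> fits into \<open>m\<close>, the
  remainder is below \<open>FF (n - 1)\<close>, so the next digit can be 0 and the induction
  continues two places further down.\<close>

lemma zeck_word_exists: "m < FF (Suc n) \<Longrightarrow> \<exists>b. zeck_word b \<and> length b = n \<and> dotF b = m"
proof (induction n arbitrary: m rule: less_induct)
  case (less n)
  show ?case
  proof (cases n)
    case 0
    then show ?thesis using less.prems by simp
  next
    case (Suc k)
    show ?thesis
    proof (cases "m < FF n")
      case True
      then obtain b where "zeck_word b" "length b = k" "dotF b = m"
        using less.IH[of k m] Suc by auto
      then show ?thesis using Suc by (intro exI[of _ "0 # b"]) (auto simp: zeck_word_Cons)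
    next
      case False
      show ?thesis
      proof (cases k)
        case 0
        then have "m = 1" using False less.prems Suc by simp
        then show ?thesis using Suc 0 by (intro exI[of _ "[1]"]) (auto simp: zeck_word_Cons)
      next
        case (Suc l)
        then have "m - FF n < FF (Suc l)"
          using False less.prems \<open>n = Suc k\<close> by auto
        then obtain b where "zeck_word b" "length b = l" "dotF b = m - FF n"
          using less.IH[of l] Suc \<open>n = Suc k\<close> by auto
        then show ?thesis
          using False Suc \<open>n = Suc k\<close> by (intro exI[of _ "1 # 0 # b"]) (auto simp: zeck_word_Cons)
      qed
    qed
  qed
qed

lemma zeck_word_lead:
  assumes "zeck_word b" "b \<noteq> []" "FF (length b) \<le> dotF b"
  shows "lead_word b"
proof (cases b)
  case (Cons x xs)
  then show ?thesis
    using assms zeck_word_less[of xs] by (auto simp: lead_word_def zeck_word_Cons)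
qed (use assms in simp)

text \<open>For \<open>m \<ge> 1\<close> this is the number of Zeckendorf digits of
  \<open>m\<close>. Because \<open>FF 0 = FF 1\<close>, the greatest index is then never 0.\<close>

definition level :: "nat \<Rightarrow> nat" where
  "level m = (GREATEST M. FF M \<le> m)"

lemma le_level: "FF M \<le> m \<Longrightarrow> M \<le> level m"
  unfolding level_def
  by (rule Greatest_le_nat[where P="\<lambda>M. FF M \<le> m" and b=m]) (use FF_ge_self order_trans in blast)+

lemma level_bracket:
  assumes "m \<ge> 1"
  shows "level m \<ge> 1" "FF (level m) \<le> m" "m < FF (Suc (level m))"
proof -
  have 1: "FF 1 \<le> m" using assms by simp
  show "level m \<ge> 1" by (rule le_level[OF 1])
  show "FF (level m) \<le> m"
    unfolding level_def
    by (rule GreatestI_nat[where P="\<lambda>M. FF M \<le> m" and b=m, OF 1]) (use FF_ge_self order_trans in blast)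
  show "m < FF (Suc (level m))" using le_level[of "Suc (level m)" m] by force
qed

lemma filterlim_level: "filterlim level at_top at_top"
  unfolding filterlim_at_top by (auto intro: eventually_at_top_linorderI le_level)

lemma lead_word_exists:
  assumes "FF M \<le> m" "m < FF (Suc M)" "M \<ge> 1"
  obtains e where "lead_word e" "length e = M" "dotF e = m"
proof -
  obtain b where "zeck_word b" "length b = M" "dotF b = m" using zeck_word_exists[OF assms(2)] by blast
  then show ?thesis using assms zeck_word_lead[of b] that[of b] by fastforce
qed

lemma FF_bracket_unique:
  assumes "FF M \<le> m" "m < FF (Suc M)" "FF N \<le> m" "m < FF (Suc N)"
  shows "M = N"
  by (metis FF_mono Suc_leI assms leD le_less_trans linorder_neqE_nat)

text \<open>The value lies between consecutive Fibonacci numbers determined by the length, so both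
  lengths agree and uniqueness at fixed length applies.\<close>

lemma lead_word_unique:
  assumes "lead_word b" "lead_word b'" "dotF b = dotF b'"
  shows "b = b'"
proof (rule zeck_word_unique)
  show "zeck_word b" "zeck_word b'" using assms by (auto simp: lead_word_def)
  then show "length b = length b'"
    using FF_bracket_unique[of "length b" "dotF b" "length b'"] lead_word_ge assms zeck_word_less
    by metis
qed (use assms in simp)

section \<open>Translation of digit functions into words\<close>

lemma zeck_rep_iff:
  "zeck_rep m M eps \<longleftrightarrow> lead_word (map eps [1..<M + 1]) \<and> dotF (map eps [1..<M + 1]) = m"
proof -
  let ?e = "map eps [1..<M + 1]"
  have len: "length ?e = M" by simp
  have nth: "?e ! k = eps (Suc k)" if "k < M" for k using that by (simp del: upt_Suc)
  have bits: "(\<forall>k\<in>{1..M}. eps k \<in> {0, 1}) \<longleftrightarrow> (\<forall>k<M. ?e ! k \<in> {0, 1})"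
    using nth by (metis One_nat_def Suc_le_eq Suc_pred atLeastAtMost_iff less_Suc_eq_le not_less_eq_eq zero_less_Suc)
  have gaps: "(\<forall>k\<in>{1..<M}. eps k * eps (k + 1) = 0) \<longleftrightarrow> (\<forall>k. Suc k < M \<longrightarrow> ?e ! k * ?e ! Suc k = 0)"
  proof -
    have "(\<forall>k\<in>{1..<M}. eps k * eps (k + 1) = 0) \<longleftrightarrow> (\<forall>k. Suc k < M \<longrightarrow> eps (Suc k) * eps (Suc (Suc k)) = 0)"
      by (metis One_nat_def Suc_eq_plus1 Suc_le_eq Suc_pred atLeastLessThan_iff zero_less_Suc)
    then show ?thesis using nth by simp
  qed
  have val: "(\<Sum>k=1..M. eps k * FF (M - k + 1)) = dotF ?e"
    unfolding dotF_def len by (intro sum.cong) (auto simp: nth simp del: upt_Suc)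
  have lead: "M \<ge> 1 \<and> eps 1 = 1 \<longleftrightarrow> ?e \<noteq> [] \<and> hd ?e = 1"
    by (cases M) (auto simp: upt_conv_Cons simp del: upt_Suc)
  have "zeck_rep m M eps \<longleftrightarrow> (M \<ge> 1 \<and> eps 1 = 1) \<and> (\<forall>k\<in>{1..M}. eps k \<in> {0, 1}) \<and>
      (\<forall>k\<in>{1..<M}. eps k * eps (k + 1) = 0) \<and> m = (\<Sum>k=1..M. eps k * FF (M - k + 1))"
    unfolding zeck_rep_def by blast
  then show ?thesis
    unfolding bits gaps val lead lead_word_def zeck_word_nth len by blast
qed

text \<open>The normalisation to 0 outside \<open>{1..M}\<close> fixes the digit function
  everywhere, which gives the definite description exactly one solution.\<close>

lemma zeck_exp_eq:
  assumes "lead_word e"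
  shows "zeck_exp (dotF e) = (length e, \<lambda>k. if k = 0 \<or> length e < k then 0 else e ! (k - 1))"
proof -
  define eps where "eps = (\<lambda>k. if k = 0 \<or> length e < k then 0 else e ! (k - 1))"
  have map: "map eps [1..<length e + 1] = e"
    by (rule nth_equalityI) (auto simp: eps_def simp del: upt_Suc)
  show ?thesis
    unfolding zeck_exp_def eps_def[symmetric]
  proof (rule the_equality)
    show "case (length e, eps) of (M, eps) \<Rightarrow>
        zeck_rep (dotF e) M eps \<and> (\<forall>k. k = 0 \<or> M < k \<longrightarrow> eps k = 0)"
      using assms map by (auto simp: zeck_rep_iff eps_def simp del: upt_Suc)
  next
    fix p assume "case p of (M, eps) \<Rightarrow>
        zeck_rep (dotF e) M eps \<and> (\<forall>k. k = 0 \<or> M < k \<longrightarrow> eps k = 0)"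
    then obtain N d where p: "p = (N, d)" and d: "lead_word (map d [1..<N + 1])"
      "dotF (map d [1..<N + 1]) = dotF e" "\<And>k. k = 0 \<or> N < k \<Longrightarrow> d k = 0"
      by (cases p) (auto simp only: zeck_rep_iff prod.case)
    have eq: "map d [1..<N + 1] = e" using d assms by (intro lead_word_unique) auto
    then have N: "N = length e" by (metis add_diff_cancel_right' length_map length_upt)
    have "d k = eps k" for k
    proof (cases "k = 0 \<or> N < k")
      case False
      then have "map d [1..<N + 1] ! (k - 1) = d k" by (auto simp del: upt_Suc)
      then have "e ! (k - 1) = d k" unfolding eq .
      then show ?thesis using False by (simp add: eps_def N)
    qed (use d(3) N in \<open>auto simp: eps_def\<close>)
    then show "p = (length e, eps)" using p N by auto
  qed
qed

lemma LB_lead_word: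
  assumes "lead_word e"
  shows "LB s (dotF e) = (if s \<le> length e then Some (take s e) else None)"
proof -
  have "dotF e \<noteq> 0" using lead_word_ge[OF assms] FF_pos[of "length e"] by linarith
  moreover have "map (\<lambda>k. if k = 0 \<or> length e < k then 0 else e ! (k - 1)) [1..<s + 1] = take s e"
    if "s \<le> length e"
    using that by (intro nth_equalityI) (auto simp del: upt_Suc)
  ultimately show ?thesis by (simp add: LB_def zeck_exp_eq[OF assms] del: upt_Suc)
qed

lemma lead_word_take: "lead_word e \<Longrightarrow> s \<ge> 1 \<Longrightarrow> lead_word (take s e)"
  unfolding lead_word_def using zeck_word_append1[of "take s e" "drop s e"] by auto

text \<open>A leading word of length \<open>s\<close> is the leading block of the very integer it
  represents.\<close>

lemma FS_eq:
  assumes "s \<ge> 1"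
  shows "FS s = {b. lead_word b \<and> length b = s}"
proof (intro equalityI subsetI)
  fix b assume "b \<in> FS s"
  then obtain m where m: "m \<ge> 1" "LB s m = Some b" by (auto simp: FS_def)
  obtain e where "lead_word e" "dotF e = m"
    using lead_word_exists level_bracket[OF m(1)] by metis
  then show "b \<in> {b. lead_word b \<and> length b = s}"
    using m LB_lead_word[of e s] lead_word_take[of e s] assms by (auto split: if_splits)
next
  fix b assume b: "b \<in> {b. lead_word b \<and> length b = s}"
  then have "dotF b \<ge> 1" using lead_word_ge[of b] FF_pos[of "length b"]
    unfolding mem_Collect_eq by linarith
  then show "b \<in> FS s" using b LB_lead_word[of b s] by (auto simp: FS_def)
qed

section \<open>The successor block and the cuts\<close>

lemma length_bspecial [simp]: "length (bspecial s) = s"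
  by (simp add: bspecial_def del: upt_Suc)

lemma bspecial_Suc_Suc:
  assumes "s \<ge> 2"
  shows "bspecial (Suc (Suc s)) = 1 # 0 # bspecial s"
proof (rule nth_equalityI)
  fix i assume "i < length (bspecial (Suc (Suc s)))"
  then show "bspecial (Suc (Suc s)) ! i = (1 # 0 # bspecial s) ! i"
    using assms by (auto simp: bspecial_def nth_Cons split: nat.splits simp del: upt_Suc)
qed simp

text \<open>The adjacent ones merge by the recursion, and the sum then collapses upwards through the
  preceding blocks \<open>1, 0\<close>. Thus this word, which is not a Zeckendorf word, marks the
  upper end of every level.\<close>

lemma dotF_bspecial:
  "s \<ge> 2 \<Longrightarrow> dotF (bspecial s @ replicate t 0) = FF (Suc (s + t))"
proof (induction s rule: less_induct)
  case (less s)
  have t0: "dotF (replicate n 0) = 0" for n by (induction n) auto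
  consider "s = 2" | "s = 3" | "s \<ge> 4" using less.prems by linarith
  then show ?case
  proof cases
    case 1
    have "bspecial 2 = [1, 1]" by (simp add: bspecial_def upt_rec numeral_2_eq_2)
    then show ?thesis using 1 t0 by (simp add: numeral_2_eq_2)
  next
    case 2
    have "bspecial 3 = [1, 1, 0]" by (simp add: bspecial_def upt_rec numeral_3_eq_3)
    then show ?thesis using 2 t0 by (simp add: numeral_3_eq_3)
  next
    case 3
    then obtain r where r: "s = Suc (Suc r)" "r \<ge> 2"
      by (metis Suc_le_D Suc_le_mono numeral_2_eq_2 numeral_Bit0 add_2_eq_Suc' numeral_eq_Suc pred_numeral_simps(2))
    then show ?thesis using less.IH[of r] by (simp add: bspecial_Suc_Suc)
  qed
qed

text \<open>Integers from \<open>FF s\<close> up to but excluding \<open>FF (Suc s)\<close> are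
  values of leading words of length \<open>s\<close>. Hence a successor is missing only if
  \<open>dotF b + 1 = FF (Suc s)\<close>, which is the value of \<open>bspecial s\<close>.\<close>

lemma btilde_cases:
  assumes "s \<ge> 2" "b \<in> FS s"
  shows "btilde s b \<in> FS s \<or> btilde s b = bspecial s" "dotF (btilde s b) = Suc (dotF b)"
proof -
  have b: "lead_word b" "length b = s" using assms by (auto simp: FS_eq)
  have "(btilde s b \<in> FS s \<or> btilde s b = bspecial s) \<and> dotF (btilde s b) = Suc (dotF b)"
  proof (cases "\<exists>b'\<in>FS s. dotF b' = dotF b + 1")
    case True
    then have "\<exists>!b'. b' \<in> FS s \<and> dotF b' = dotF b + 1"
      using assms by (auto simp: FS_eq intro: lead_word_unique)
    from theI'[OF this] show ?thesis using True by (simp add: btilde_def)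
  next
    case False
    have "\<not> Suc (dotF b) < FF (Suc s)"
    proof
      assume *: "Suc (dotF b) < FF (Suc s)"
      have "FF s \<le> Suc (dotF b)" using lead_word_ge[OF b(1)] b by simp
      with * obtain e where "lead_word e" "length e = s" "dotF e = Suc (dotF b)"
        using lead_word_exists[of s "Suc (dotF b)"] assms by auto
      then show False using False assms by (auto simp: FS_eq)
    qed
    then have "Suc (dotF b) = FF (Suc s)"
      using zeck_word_less[of b] b by (auto simp: lead_word_def)
    then show ?thesis using False dotF_bspecial[OF assms(1), of 0] by (simp add: btilde_def)
  qed
  then show "btilde s b \<in> FS s \<or> btilde s b = bspecial s" "dotF (btilde s b) = Suc (dotF b)" by auto
qed

text \<open>Different blocks keep their order whatever digits follow, and an integer is never below
  the cut of its own block. For \<open>bspecial s\<close> both sides are true, since its cut is the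
  end of the level.\<close>

lemma less_cut_iff:
  assumes s: "s \<ge> 2" and c: "c \<in> FS s \<or> c = bspecial s" and e: "lead_word e" "s \<le> length e"
  shows "dotF e < dotF (c @ replicate (length e - s) 0) \<longleftrightarrow> dotF (take s e) < dotF c"
  using c
proof
  assume "c = bspecial s"
  moreover have "dotF e < FF (Suc (length e))" "dotF (take s e) < FF (Suc s)"
    using zeck_word_less[of e] zeck_word_less[of "take s e"] e lead_word_take[OF e(1), of s] s
    by (auto simp: lead_word_def)
  ultimately show ?thesis
    using dotF_bspecial[OF s, of 0] dotF_bspecial[OF s, of "length e - s"] e by simp
next
  assume "c \<in> FS s"
  then have c: "zeck_word c" "length c = s" using s by (auto simp: FS_eq lead_word_def)
  have t: "zeck_word (take s e)" using lead_word_take[OF e(1), of s] s by (simp add: lead_word_def)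
  have z: "zeck_word e" using e by (simp add: lead_word_def)
  have le: "dotF (take s e @ replicate (length e - s) 0) \<le> dotF e"
    using dotF_append[of "take s e" "drop s e"] by simp
  show ?thesis
  proof
    assume "dotF (take s e) < dotF c"
    then show "dotF e < dotF (c @ replicate (length e - s) 0)"
      using zeck_word_less_extend[of "take s e" "drop s e" c] z c e by simp
  next
    assume *: "dotF e < dotF (c @ replicate (length e - s) 0)"
    show "dotF (take s e) < dotF c"
    proof (rule ccontr)
      assume "\<not> dotF (take s e) < dotF c"
      then consider "dotF c < dotF (take s e)" | "dotF c = dotF (take s e)" by linarith
      then show False
      proof cases
        case 1
        have "zeck_word (c @ replicate n 0)" for n
          using c(1) by (auto simp: zeck_word_nth nth_append)
        then have "dotF (c @ replicate (length e - s) 0) < dotF (take s e @ replicate (length e - s) 0)"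
          using zeck_word_less_extend[of c "replicate (length e - s) 0" "take s e"] 1 t c e by simp
        then show False using le * by linarith
      next
        case 2
        then have "c = take s e" using c t e by (intro zeck_word_unique) auto
        then show False using le * by simp
      qed
    qed
  qed
qed

text \<open>The values of \<open>b\<close> and its successor differ by 1, so lying below the second
  cut splits into two exclusive cases: block \<open>b\<close>, or below the first cut. This makes
  the wanted frequency a difference of two.\<close>

lemma less_cut_btilde_iff:
  assumes s: "s \<ge> 2" and b: "b \<in> FS s" and M: "s \<le> M" "FF M \<le> m" "m < FF (Suc M)"
  shows "m < dotF (btilde s b @ replicate (M - s) 0) \<longleftrightarrow>
           LB s m = Some b \<or> m < dotF (b @ replicate (M - s) 0)"
    and "LB s m = Some b \<Longrightarrow> \<not> m < dotF (b @ replicate (M - s) 0)"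
proof -
  obtain e where e: "lead_word e" "length e = M" "dotF e = m"
    using lead_word_exists[OF M(2,3)] M s by auto
  have "LB s m = Some b \<longleftrightarrow> take s e = b"
    using LB_lead_word[OF e(1), of s] e M by simp
  also have "\<dots> \<longleftrightarrow> dotF (take s e) = dotF b"
    using b s lead_word_take[OF e(1), of s] lead_word_unique[of "take s e" b] by (auto simp: FS_eq)
  finally have LB: "LB s m = Some b \<longleftrightarrow> dotF (take s e) = dotF b" .
  have cut: "m < dotF (b @ replicate (M - s) 0) \<longleftrightarrow> dotF (take s e) < dotF b"
    "m < dotF (btilde s b @ replicate (M - s) 0) \<longleftrightarrow> dotF (take s e) < Suc (dotF b)"
    using less_cut_iff[OF s _ e(1), of b] less_cut_iff[OF s btilde_cases(1)[OF s b] e(1)]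
      btilde_cases(2)[OF s b] b e M by simp_all
  show "m < dotF (btilde s b @ replicate (M - s) 0) \<longleftrightarrow>
           LB s m = Some b \<or> m < dotF (b @ replicate (M - s) 0)"
    and "LB s m = Some b \<Longrightarrow> \<not> m < dotF (b @ replicate (M - s) 0)"
    unfolding LB cut by auto
qed

text \<open>This confines the normalised cuts, and with them their limits, to \<open>[0, 1]\<close>,
  the range of \<open>finf\<close>.\<close>

lemma cut_bounds:
  assumes s: "s \<ge> 2" "s \<le> M" and c: "c \<in> FS s \<or> c = bspecial s"
  shows "FF M \<le> dotF (c @ replicate (M - s) 0)" "dotF (c @ replicate (M - s) 0) \<le> FF (Suc M)"
proof -
  have "FF M \<le> dotF (c @ replicate (M - s) 0) \<and> dotF (c @ replicate (M - s) 0) \<le> FF (Suc M)"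
    using c
  proof
    assume "c \<in> FS s"
    then have c: "lead_word c" "length c = s" using s by (auto simp: FS_eq)
    then have "lead_word (c @ replicate (M - s) 0)"
      unfolding lead_word_def zeck_word_nth by (auto simp: nth_append)
    then show ?thesis
      using lead_word_ge[of "c @ replicate (M - s) 0"] zeck_word_less[of "c @ replicate (M - s) 0"] c s
      by (auto simp: lead_word_def)
  next
    assume "c = bspecial s"
    then show ?thesis using dotF_bspecial[OF s(1), of "M - s"] s FF_Suc_le[of M] by simp
  qed
  then show "FF M \<le> dotF (c @ replicate (M - s) 0)" "dotF (c @ replicate (M - s) 0) \<le> FF (Suc M)" by auto
qed

section \<open>Asymptotics of the cuts\<close>

lemma phi_gt_1: "phi > 1"
  by (simp add: phi_def)

lemma phi_square: "phi * phi = phi + 1"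
  by (simp add: phi_def field_simps)

lemma sqrt5_phi: "sqrt 5 = 2 * phi - 1"
  by (simp add: phi_def field_simps)

lemma omega_phi: "omega = phi - 1"
proof -
  have "phi * (phi - 1) = 1" using phi_square by (simp add: algebra_simps)
  then show ?thesis unfolding omega_def by (rule inverse_unique)
qed

lemma omega_bounds: "0.618 < omega" "omega < 0.62"
proof -
  have "2.236 < sqrt (5::real)" by (rule real_less_rsqrt) (simp add: power2_eq_square)
  moreover have "sqrt (5::real) < 2.24" by (rule real_less_lsqrt) (simp_all add: power2_eq_square)
  ultimately show "0.618 < omega" "omega < 0.62" by (simp_all add: omega_phi phi_def field_simps)
qed

lemma omega_square: "omega * omega = 1 - omega"
  using phi_square by (simp add: omega_phi algebra_simps)

lemma phi_omega: "phi * omega = 1"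
  using phi_gt_1 by (simp add: omega_def)

text \<open>Binet's formula, shifted by one index; the second root of \<open>x * x = x + 1\<close>
  is \<open>- omega\<close>. The induction runs after clearing the denominator
  \<open>sqrt 5 = 2 * phi - 1\<close>.\<close>

lemma FF_closed_form: "real (FF n) = phi / sqrt 5 * (phi ^ n + (-1) ^ n * omega ^ (n + 2))"
proof -
  have s: "2 * phi - 1 \<noteq> 0" using phi_gt_1 by simp
  have "real (FF n) * (2 * phi - 1) = phi * (phi ^ n + (-1) ^ n * omega ^ (n + 2))"
  proof (induction n rule: FF.induct)
    case 1
    have "phi * (1 + omega * omega) = 2 * phi - phi * omega"
      by (simp add: omega_square algebra_simps)
    then show ?case by (simp add: power2_eq_square phi_omega)
  next
    case 2
    have "phi * (phi - omega * (omega * omega)) = phi * phi - phi * omega * (omega * omega)"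
      by (simp add: algebra_simps)
    also have "\<dots> = 2 * phi - 1" unfolding phi_omega phi_square omega_square by (simp add: omega_phi)
    finally show ?case by (simp add: power3_eq_cube eval_nat_numeral)
  next
    case (3 n)
    have p: "phi ^ Suc (Suc n) = phi ^ Suc n + phi ^ n"
      using phi_square by (simp add: mult.assoc[symmetric] algebra_simps)
    have "omega ^ (Suc (Suc n) + 2) = omega ^ (n + 2) * (omega * omega)" by simp
    then have o: "omega ^ (Suc (Suc n) + 2) = omega ^ (n + 2) - omega ^ (Suc n + 2)"
      by (simp only: omega_square) (simp add: algebra_simps)
    show ?case
      using 3 unfolding o p by (simp add: algebra_simps)
  qed
  then show ?thesis using s by (simp add: sqrt5_phi field_simps)
qed

lemma FrakF_of_nat: "FrakF (real n) = real (FF n)"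
proof -
  have "phi powr (- real n) * phi powr (-2) = omega ^ (n + 2)"
    using phi_gt_1 by (simp add: powr_minus powr_realpow omega_def power_add power_inverse power2_eq_square)
  then have "phi powr (- real n) * cos (pi * real n) * phi powr (-2) = (-1) ^ n * omega ^ (n + 2)"
    using cos_npi[of n] by (simp add: mult.commute mult.left_commute)
  then show ?thesis
    using phi_gt_1 by (simp add: FrakF_def FF_closed_form powr_realpow)
qed

lemma FF_over_power_tendsto: "(\<lambda>n. real (FF n) / phi ^ n) \<longlonglongrightarrow> phi / sqrt 5"
proof -
  have "(\<lambda>n. phi / sqrt 5 * (1 + omega\<^sup>2 * (- (omega * omega)) ^ n)) \<longlonglongrightarrow> phi / sqrt 5 * (1 + omega\<^sup>2 * 0)"
    using omega_square omega_bounds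
    by (intro tendsto_intros LIMSEQ_power_zero) (simp_all add: abs_less_iff)
  moreover have "real (FF n) / phi ^ n = phi / sqrt 5 * (1 + omega\<^sup>2 * (- (omega * omega)) ^ n)" for n
  proof -
    have "(-1) ^ n * omega ^ (n + 2) / phi ^ n = omega\<^sup>2 * (- (omega * omega)) ^ n"
      unfolding power_minus[of "omega * omega"]
      by (simp add: omega_def power_mult_distrib power_add divide_inverse power_inverse power2_eq_square)
    moreover have "real (FF n) / phi ^ n = phi / sqrt 5 * (1 + (-1) ^ n * omega ^ (n + 2) / phi ^ n)"
      unfolding FF_closed_form times_divide_eq_right[symmetric] add_divide_distrib using phi_gt_1 by simp
    ultimately show ?thesis by simp
  qed
  ultimately show ?thesis by simp
qed

lemma FF_diff_over_power_tendsto: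
  "(\<lambda>M. real (FF (M - j)) / phi ^ M) \<longlonglongrightarrow> phi / sqrt 5 * omega ^ j"
\<comment> \<open>Shifting the index by \<open>j\<close> removes the truncated subtraction.\<close>
proof (rule LIMSEQ_offset[of _ j])
  have "(\<lambda>M. real (FF M) / phi ^ M * omega ^ j) \<longlonglongrightarrow> phi / sqrt 5 * omega ^ j"
    by (intro tendsto_intros FF_over_power_tendsto)
  then show "(\<lambda>M. real (FF (M + j - j)) / phi ^ (M + j)) \<longlonglongrightarrow> phi / sqrt 5 * omega ^ j"
    by (simp add: omega_def power_add divide_inverse power_inverse mult.assoc)
qed

lemma FF_Suc_over_power_tendsto:
  "(\<lambda>M. real (FF (Suc M)) / phi ^ M) \<longlonglongrightarrow> phi / sqrt 5 * phi"
proof -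
  have "(\<lambda>M. real (FF (Suc M)) / phi ^ Suc M * phi) \<longlonglongrightarrow> phi / sqrt 5 * phi"
    by (intro tendsto_intros LIMSEQ_Suc[OF FF_over_power_tendsto])
  then show ?thesis using phi_gt_1 by simp
qed

lemma dotFhat_lessThan: "dotFhat b = (\<Sum>k<length b. real (b ! k) * omega ^ k)"
  unfolding dotFhat_def
  by (rule sum.reindex_bij_witness[of _ Suc "\<lambda>k. k - 1"]) auto

lemma dotF_append_zeros:
  assumes "length c = s" "s \<le> M"
  shows "dotF (c @ replicate (M - s) 0) = (\<Sum>k<s. c ! k * FF (M - k))"
proof -
  have "dotF (c @ replicate (M - s) 0) = (\<Sum>k<M. (c @ replicate (M - s) 0) ! k * FF (M - k))"
    using assms by (simp add: dotF_lessThan)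
  also have "\<dots> = (\<Sum>k<s. (c @ replicate (M - s) 0) ! k * FF (M - k))"
    using assms by (intro sum.mono_neutral_right) (auto simp: nth_append)
  also have "\<dots> = (\<Sum>k<s. c ! k * FF (M - k))"
    using assms by (intro sum.cong) (auto simp: nth_append)
  finally show ?thesis .
qed

text \<open>After division by \<open>phi ^ M\<close>, a digit 1 at position \<open>k\<close>
  contributes \<open>omega ^ k\<close> times the limit of \<open>FF M / phi ^ M\<close>. That limit
  cancels in the quotient, and the denominator leaves \<open>phi - 1 = 1 / phi\<close>. The
  computation is digitwise and so covers \<open>bspecial s\<close> too.\<close>

lemma cut_tendsto:
  assumes "length c = s"
  shows "(\<lambda>M. (real (dotF (c @ replicate (M - s) 0)) - real (FF M)) / (real (FF (Suc M)) - real (FF M)))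
           \<longlonglongrightarrow> phi * (dotFhat c - 1)"
proof -
  let ?A = "phi / sqrt 5"
  have "(\<lambda>M. \<Sum>k<s. real (c ! k) * (real (FF (M - k)) / phi ^ M))
      \<longlonglongrightarrow> (\<Sum>k<s. real (c ! k) * (?A * omega ^ k))"
    by (intro tendsto_intros FF_diff_over_power_tendsto)
  moreover have "(\<Sum>k<s. real (c ! k) * (?A * omega ^ k)) = ?A * dotFhat c"
    by (simp add: dotFhat_lessThan assms sum_distrib_left mult.left_commute)
  ultimately have "(\<lambda>M. \<Sum>k<s. real (c ! k) * (real (FF (M - k)) / phi ^ M)) \<longlonglongrightarrow> ?A * dotFhat c"
    by simp
  then have "(\<lambda>M. real (dotF (c @ replicate (M - s) 0)) / phi ^ M) \<longlonglongrightarrow> ?A * dotFhat c"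
  proof (rule Lim_transform_eventually)
    show "\<forall>\<^sub>F M in sequentially. (\<Sum>k<s. real (c ! k) * (real (FF (M - k)) / phi ^ M)) =
        real (dotF (c @ replicate (M - s) 0)) / phi ^ M"
      using eventually_ge_at_top[of s]
      by eventually_elim (simp add: dotF_append_zeros[OF assms] sum_divide_distrib)
  qed
  then have "(\<lambda>M. (real (dotF (c @ replicate (M - s) 0)) / phi ^ M - real (FF M) / phi ^ M) /
      (real (FF (Suc M)) / phi ^ M - real (FF M) / phi ^ M))
      \<longlonglongrightarrow> (?A * dotFhat c - ?A) / (?A * phi - ?A)"
    using phi_gt_1
    by (intro tendsto_intros FF_over_power_tendsto FF_Suc_over_power_tendsto) auto
  moreover have "(?A * dotFhat c - ?A) / (?A * phi - ?A) = (?A * (dotFhat c - 1)) / (?A * (phi - 1))"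
    by (simp only: right_diff_distrib mult_1_right)
  moreover have "\<dots> = phi * (dotFhat c - 1)"
    using phi_gt_1 unfolding omega_phi[symmetric]
    by (subst mult_divide_mult_cancel_left) (simp_all add: omega_def divide_inverse)
  moreover have "(x / phi ^ M - y / phi ^ M) / (z / phi ^ M - y / phi ^ M) = (x - y) / (z - y)" for x y z M
    using phi_gt_1 by (simp add: diff_divide_distrib[symmetric])
  ultimately show ?thesis by simp
qed

lemma cut_limit_bounds:
  assumes s: "s \<ge> 2" and c: "c \<in> FS s \<or> c = bspecial s"
  shows "0 \<le> phi * (dotFhat c - 1)" "phi * (dotFhat c - 1) \<le> 1"
proof -
  have len: "length c = s" using c s by (auto simp: FS_eq)
  have "\<forall>\<^sub>F M in sequentially.
      0 \<le> (real (dotF (c @ replicate (M - s) 0)) - real (FF M)) / (real (FF (Suc M)) - real (FF M)) \<and>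
      (real (dotF (c @ replicate (M - s) 0)) - real (FF M)) / (real (FF (Suc M)) - real (FF M)) \<le> 1"
    using eventually_ge_at_top[of s]
  proof eventually_elim
    case (elim M)
    then show ?case
      using cut_bounds[OF s _ c, of M] FF_less_Suc[of M] s by (auto simp: divide_le_eq)
  qed
  then show "0 \<le> phi * (dotFhat c - 1)" "phi * (dotFhat c - 1) \<le> 1"
    using tendsto_lowerbound[OF cut_tendsto[OF len]] tendsto_upperbound[OF cut_tendsto[OF len]]
    by (auto simp: eventually_conj_iff)
qed

section \<open>The analytic interpolation\<close>

text \<open>With the end values fixed, the intermediate value theorem makes \<open>g\<close> onto.
  This turns \<open>the_inv_into\<close> into a genuine inverse, for \<open>FrakFn n\<close> as well
  as for \<open>finf\<close>.\<close>

lemma the_inv_into_interval: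
  fixes g :: "real \<Rightarrow> real"
  assumes g: "strict_mono_on {0..1} g" "continuous_on {0..1} g" "g 0 = 0" "g 1 = 1" and y: "y \<in> {0..1}"
  shows "the_inv_into {0..1} g y \<in> {0..1}" "g (the_inv_into {0..1} g y) = y"
proof -
  have inj: "inj_on g {0..1}" using g(1) by (rule strict_mono_on_imp_inj_on)
  have "\<exists>p\<ge>0. p \<le> 1 \<and> g p = y" using y g by (intro IVT') auto
  then have "y \<in> g ` {0..1}" by force
  then show "the_inv_into {0..1} g y \<in> {0..1}" "g (the_inv_into {0..1} g y) = y"
    using the_inv_into_into[OF inj _ subset_refl, of y] f_the_inv_into_f[OF inj, of y] by blast+
qed

lemma FrakF_has_derivative:
  "(FrakF has_real_derivative phi / sqrt 5 * (ln phi * phi powr x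
     - phi powr (- x - 2) * (ln phi * cos (pi * x) + pi * sin (pi * x)))) (at x)"
proof -
  have "phi powr (- x - 2) = phi powr (- x) * phi powr (-2)"
    by (simp add: powr_add[symmetric])
  then have "((\<lambda>x. phi powr x + phi powr (- x) * cos (pi * x) * phi powr (-2)) has_real_derivative
      ln phi * phi powr x - phi powr (- x - 2) * (ln phi * cos (pi * x) + pi * sin (pi * x))) (at x)"
    using phi_gt_1 by (auto intro!: derivative_eq_intros simp: algebra_simps)
  from DERIV_cmult[OF this, of "phi / sqrt 5"] show ?thesis
    unfolding FrakF_def [abs_def] .
qed

text \<open>The oscillating part must be dominated by the growth of \<open>phi powr x\<close>. Near
  1 this needs the sign of the sine; from 2 onwards crude numerical bounds suffice.\<close>

lemma FrakF_derivative_pos: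
  assumes "x \<ge> 1"
  shows "0 < ln phi * phi powr x - phi powr (- x - 2) * (ln phi * cos (pi * x) + pi * sin (pi * x))"
proof -
  have ln: "ln phi > 0" using phi_gt_1 by simp
  define l where "l = ln phi"
  define A where "A = phi powr x"
  define B where "B = phi powr (- x - 2)"
  have B0: "B > 0" using phi_gt_1 by (simp add: B_def)
  have AB: "B < A" using assms phi_gt_1 by (simp add: A_def B_def)
  show ?thesis
  proof (cases "x < 2")
    case True
    \<comment> \<open>Here \<open>pi * x\<close> lies between \<open>pi\<close> and
      \<open>2 * pi\<close>, so the sine term only helps.\<close>
    have "sin (pi * x) \<le> 0" using assms True by (intro sin_le_zero) auto
    then have "l * cos (pi * x) + pi * sin (pi * x) \<le> l * 1 + 0"
      using ln by (intro add_mono mult_left_mono mult_nonneg_nonpos) (auto simp: l_def)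
    then have "B * (l * cos (pi * x) + pi * sin (pi * x)) \<le> B * l"
      using B0 by (intro mult_left_mono) auto
    also have "\<dots> < l * A" using AB ln by (simp add: l_def)
    finally show ?thesis by (simp add: l_def A_def B_def)
  next
    case False
    have "l * cos (pi * x) + pi * sin (pi * x) \<le> l * 1 + pi * 1"
      using ln by (intro add_mono mult_left_mono) (auto simp: l_def)
    then have "B * (l * cos (pi * x) + pi * sin (pi * x)) \<le> B * (l + pi)"
      using B0 by (intro mult_left_mono) auto
    also have "\<dots> < l * A"
    proof -
      have p2: "phi powr 2 = phi * phi" using phi_gt_1 by (simp add: powr_numeral power2_eq_square)
      have "phi powr 2 \<le> A" unfolding A_def using False phi_gt_1 by (intro powr_mono) auto
      then have A: "2.618 \<le> A" using omega_bounds unfolding p2 phi_square by (simp add: omega_phi)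
      have "B \<le> phi powr (- 4)" unfolding B_def using False phi_gt_1 by (intro powr_mono) auto
      also have "phi powr (- 4) = omega ^ 4"
        using phi_gt_1 by (simp add: powr_minus powr_numeral omega_def power_inverse)
      also have "\<dots> = 2 - 3 * omega"
      proof -
        have "omega ^ 4 = (omega * omega) * (omega * omega)" by (simp add: eval_nat_numeral)
        also have "\<dots> = 2 - 3 * omega" by (simp add: omega_square algebra_simps)
        finally show ?thesis .
      qed
      finally have B: "B \<le> 0.146" using omega_bounds by simp
      \<comment> \<open>From \<open>ln y \<le> y - 1\<close> at \<open>y = 1 / phi\<close>. The
        final comparison is between at most \<open>0.584\<close> and at least
        \<open>0.93\<close>.\<close>
      have "1 - 1 / phi \<le> l" unfolding l_def using phi_gt_1 ln_one_minus_pos_upper_bound[of "1 - 1 / phi"]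
        by (simp add: ln_div)
      then have l: "0.38 \<le> l" using omega_bounds by (simp add: omega_def inverse_eq_divide)
      have "B * pi \<le> 0.146 * 4" using B B0 pi_less_4 by (intro mult_mono) auto
      moreover have "0.38 * (2.618 - 0.146) \<le> l * (A - B)" using l A B by (intro mult_mono) auto
      ultimately show ?thesis by (simp add: algebra_simps)
    qed
    finally show ?thesis by (simp add: l_def A_def B_def)
  qed
qed

lemma FrakF_strict_mono: "1 \<le> x \<Longrightarrow> x < y \<Longrightarrow> FrakF x < FrakF y"
proof (rule DERIV_pos_imp_increasing[of x y FrakF])
  fix t assume "1 \<le> x" "x \<le> t"
  then have "0 < phi / sqrt 5 * (ln phi * phi powr t
      - phi powr (- t - 2) * (ln phi * cos (pi * t) + pi * sin (pi * t)))"
    using FrakF_derivative_pos[of t] phi_gt_1 by (intro mult_pos_pos) auto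
  then show "\<exists>y. (FrakF has_real_derivative y) (at t) \<and> 0 < y"
    using FrakF_has_derivative by blast
qed

lemma FrakF_inverse:
  assumes n: "n \<ge> 1" and y: "y \<in> {0..1}"
  shows "FrakF (real n + the_inv_into {0..1} (FrakFn n) y)
       = real (FF n) + y * (real (FF (Suc n)) - real (FF n))"
proof -
  have d: "0 < real (FF (Suc n)) - real (FF n)" using FF_less_Suc[OF n] by simp
  have mono: "strict_mono_on {0..1} (FrakFn n)"
  proof (rule strict_mono_onI)
    fix p q :: real assume "p \<in> {0..1}" "q \<in> {0..1}" "p < q"
    then have "FrakF (real n + p) < FrakF (real n + q)" using n by (intro FrakF_strict_mono) auto
    then show "FrakFn n p < FrakFn n q" using d by (simp add: FrakFn_def divide_strict_right_mono)
  qed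
  have 1: "FrakF (real n + 1) = real (FF (Suc n))" using FrakF_of_nat[of "Suc n"] by (simp add: add.commute)
  have cont: "continuous_on UNIV FrakF"
    by (intro continuous_at_imp_continuous_on ballI DERIV_isCont[OF FrakF_has_derivative])
  have "continuous_on {0..1} (\<lambda>p. FrakF (real n + p))"
    by (rule continuous_on_compose2[OF cont]) (auto intro!: continuous_intros)
  then have "continuous_on {0..1} (FrakFn n)"
    unfolding FrakFn_def [abs_def]
    using d by (intro continuous_on_divide continuous_on_diff continuous_on_const) auto
  from the_inv_into_interval(2)[OF mono this _ _ y]
  have "FrakFn n (the_inv_into {0..1} (FrakFn n) y) = y"
    using d by (simp add: FrakFn_def FrakF_of_nat 1)
  then show ?thesis using d by (simp add: FrakFn_def FrakF_of_nat field_simps)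
qed

section \<open>Uniform continuations\<close>

context
  fixes f finf :: "real \<Rightarrow> real"
  assumes uc: "uniform_continuation f finf"
begin

lemma continuation_less_iff: "1 \<le> x \<Longrightarrow> 1 \<le> y \<Longrightarrow> f x < f y \<longleftrightarrow> x < y"
  using uc strict_mono_on_less[of "{1..}" f x y] by (simp add: uniform_continuation_def)

lemma continuation_of_nat: "n \<ge> 1 \<Longrightarrow> f (real n) = real (FF n)"
  using uc by (simp add: uniform_continuation_def)

lemma continuation_inj: "inj_on f {1..}"
  using uc by (auto simp: uniform_continuation_def intro: strict_mono_on_imp_inj_on)

lemma finf_strict_mono: "strict_mono_on {0..1} finf"
  using uc by (simp add: uniform_continuation_def)

lemma finf_less: "0 \<le> p \<Longrightarrow> p < q \<Longrightarrow> q \<le> 1 \<Longrightarrow> finf p < finf q"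
  using finf_strict_mono by (auto simp: strict_mono_on_def)

lemma finf_le: "0 \<le> p \<Longrightarrow> p \<le> q \<Longrightarrow> q \<le> 1 \<Longrightarrow> finf p \<le> finf q"
  using finf_less[of p q] by (cases "p = q") auto

lemma fn_seq_eq:
  assumes "n \<ge> 1"
  shows "fn_seq f n p = (f (real n + p) - real (FF n)) / (real (FF (Suc n)) - real (FF n))"
  using continuation_of_nat[of n] continuation_of_nat[of "Suc n"] assms
  by (simp add: fn_seq_def add.commute)

lemma fn_seq_uniform:
  assumes "e > 0"
  shows "\<forall>\<^sub>F n in sequentially. \<forall>p\<in>{0..1}. \<bar>fn_seq f n p - finf p\<bar> < e"
proof -
  have "uniform_limit {0..1} (\<lambda>n p. fn_seq f n p) finf sequentially"
    using uc by (simp add: uniform_continuation_def)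
  from uniform_limitD[OF this assms] show ?thesis by (simp add: dist_real_def)
qed

lemma fn_seq_tendsto: "p \<in> {0..1} \<Longrightarrow> (\<lambda>n. fn_seq f n p) \<longlonglongrightarrow> finf p"
  using uc by (auto simp: uniform_continuation_def intro: tendsto_uniform_limitI)

text \<open>The definition only places the values of \<open>finf\<close> in \<open>[0, 1]\<close>.
  The end values come from those of \<open>fn_seq f n\<close> and make \<open>finf\<close> a
  bijection of \<open>[0, 1]\<close>.\<close>

lemma finf_0: "finf 0 = 0"
proof -
  have "(\<lambda>n. fn_seq f n 0) \<longlonglongrightarrow> finf 0" by (rule fn_seq_tendsto) simp
  then show ?thesis by (simp add: fn_seq_def LIMSEQ_const_iff)
qed

lemma finf_1: "finf 1 = 1"
proof -
  have "(\<lambda>n. fn_seq f n 1) \<longlonglongrightarrow> finf 1" by (rule fn_seq_tendsto) simp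
  moreover have "\<forall>\<^sub>F n in sequentially. fn_seq f n 1 = 1"
    using eventually_ge_at_top[of 1]
  proof eventually_elim
    case (elim n)
    then have "f (real n) < f (real n + 1)" by (subst continuation_less_iff) auto
    then show ?case by (simp add: fn_seq_def)
  qed
  ultimately have "(\<lambda>n::nat. 1) \<longlonglongrightarrow> finf 1" by (rule Lim_transform_eventually)
  then show ?thesis by (simp add: LIMSEQ_const_iff)
qed

lemma finf_inverse:
  assumes "y \<in> {0..1}"
  shows "the_inv_into {0..1} finf y \<in> {0..1}" "finf (the_inv_into {0..1} finf y) = y"
  using the_inv_into_interval[OF finf_strict_mono _ finf_0 finf_1 assms] uc
  by (auto simp: uniform_continuation_def)

text \<open>Since \<open>f\<close> takes the values \<open>FF M\<close> and
  \<open>FF (Suc M)\<close> at \<open>M\<close> and \<open>M + 1\<close>, the preimage of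
  \<open>m\<close> lies in between. Its integer part is therefore the level of
  \<open>m\<close>.\<close>

lemma continuation_inverse_of_nat:
  assumes "M \<ge> 1" "FF M \<le> m" "m < FF (Suc M)"
  shows "f (real M + frac (the_inv_into {1..} f (real m))) = real m"
proof -
  have "continuous_on {real M..real M + 1} f"
    using uc assms by (auto simp: uniform_continuation_def intro: continuous_on_subset)
  then have "\<exists>x\<ge>real M. x \<le> real M + 1 \<and> f x = real m"
    using assms continuation_of_nat[of M] continuation_of_nat[of "Suc M"]
    by (intro IVT') (auto simp: add.commute)
  then obtain x where x: "real M \<le> x" "x \<le> real M + 1" "f x = real m" by blast
  have "f x < f (real M + 1)"
    using x assms continuation_of_nat[of "Suc M"] by (simp add: add.commute)
  then have "x < real M + 1" using x assms by (subst (asm) continuation_less_iff) auto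
  then have "frac x = x - real M"
    using x by (simp add: frac_unique_iff)
  moreover have "the_inv_into {1..} f (real m) = x"
    using continuation_inj x assms by (intro the_inv_into_f_eq) auto
  ultimately show ?thesis using x by simp
qed

text \<open>Strict monotonicity separates \<open>finf (c - e)\<close> and
  \<open>finf (c + e)\<close> from \<open>w0 = finf c\<close>. Uniform convergence transfers the
  separation to \<open>fn_seq f n\<close> for all \<open>p\<close> at once, as needed because
  \<open>p\<close> will vary with \<open>n\<close>.\<close>

lemma fn_seq_threshold:
  assumes w: "w \<longlonglongrightarrow> w0" "w0 \<in> {0..1}" and e: "e > 0"
  defines "c \<equiv> the_inv_into {0..1} finf w0"
  shows "\<forall>\<^sub>F n in sequentially. \<forall>p\<in>{0..1}. (p \<le> c - e \<longrightarrow> fn_seq f n p < w n) \<and> (fn_seq f n p < w n \<longrightarrow> p \<le> c + e)"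
proof -
  have c: "0 \<le> c" "c \<le> 1" "finf c = w0" using finf_inverse[OF w(2)] by (auto simp: c_def)
  have "\<forall>\<^sub>F n in sequentially. \<forall>p\<in>{0..1}. p \<le> c - e \<longrightarrow> fn_seq f n p < w n"
  proof (cases "c - e < 0")
    case False
    \<comment> \<open>Half of the gap \<open>h\<close> absorbs the error of
      \<open>fn_seq f n\<close>, the other half that of \<open>w n\<close>.\<close>
    define h where "h = w0 - finf (c - e)"
    have h: "h > 0" using finf_less[of "c - e" c] False e c by (simp add: h_def)
    have "\<forall>\<^sub>F n in sequentially. w0 - h / 2 < w n" using w(1) h by (intro order_tendstoD) auto
    moreover have "\<forall>\<^sub>F n in sequentially. \<forall>p\<in>{0..1}. \<bar>fn_seq f n p - finf p\<bar> < h / 2"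
      using h by (intro fn_seq_uniform) simp
    ultimately show ?thesis
    proof eventually_elim
      case (elim n)
      show ?case
      proof (intro ballI impI)
        fix p :: real assume p: "p \<in> {0..1}" "p \<le> c - e"
        then have le: "finf p \<le> finf (c - e)" using c e by (intro finf_le) auto
        have "\<bar>fn_seq f n p - finf p\<bar> < h / 2" using elim(2) p(1) by (rule bspec)
        then have "fn_seq f n p < finf p + h / 2" by linarith
        then show "fn_seq f n p < w n" using le elim(1) unfolding h_def by (simp add: field_simps)
      qed
    qed
  qed auto
  moreover have "\<forall>\<^sub>F n in sequentially. \<forall>p\<in>{0..1}. fn_seq f n p < w n \<longrightarrow> p \<le> c + e"
  proof (cases "c + e \<ge> 1")
    case False
    define h where "h = finf (c + e) - w0"
    have h: "h > 0" using finf_less[of c "c + e"] False e c by (simp add: h_def)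
    have "\<forall>\<^sub>F n in sequentially. w n < w0 + h / 2" using w(1) h by (intro order_tendstoD) auto
    moreover have "\<forall>\<^sub>F n in sequentially. \<forall>p\<in>{0..1}. \<bar>fn_seq f n p - finf p\<bar> < h / 2"
      using h by (intro fn_seq_uniform) simp
    ultimately show ?thesis
    proof eventually_elim
      case (elim n)
      show ?case
      proof (intro ballI impI, rule ccontr)
        fix p :: real assume p: "p \<in> {0..1}" "fn_seq f n p < w n" "\<not> p \<le> c + e"
        then have le: "finf (c + e) \<le> finf p" using c e by (intro finf_le) auto
        have "\<bar>fn_seq f n p - finf p\<bar> < h / 2" using elim(2) p(1) by (rule bspec)
        then have "finf p - h / 2 < fn_seq f n p" by linarith
        then show False using le elim(1) p(2) unfolding h_def by (simp add: field_simps)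
      qed
    qed
  qed (auto intro!: always_eventually)
  ultimately show ?thesis by eventually_elim blast
qed

text \<open>Subtracting \<open>FF M\<close> and dividing by the length of level \<open>M\<close>
  turns the comparison with the cut into \<open>fn_seq f M p < w M\<close>, where \<open>p\<close>
  is the fractional part of the preimage. The threshold estimate and equidistribution then give the
  frequency.\<close>

lemma frequency_below_cut:
  assumes K: "\<And>n. n \<ge> 1 \<Longrightarrow> K n > 0" "filterlim K at_top sequentially"
    and equi: "equidistributed (\<lambda>n. the_inv_into {1..} f (real (K n)))"
    and s: "s \<ge> 2" and c: "c \<in> FS s \<or> c = bspecial s"
  shows "(\<lambda>n. real (card {k \<in> {1..n}. K k < dotF (c @ replicate (level (K k) - s) 0)}) / real n)
           \<longlonglongrightarrow> the_inv_into {0..1} finf (phi * (dotFhat c - 1))"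
proof -
  have len: "length c = s" using c s by (auto simp: FS_eq)
  define w where "w = (\<lambda>M. (real (dotF (c @ replicate (M - s) 0)) - real (FF M)) / (real (FF (Suc M)) - real (FF M)))"
  define g where "g = the_inv_into {0..1} finf (phi * (dotFhat c - 1))"
  define q where "q = (\<lambda>k. frac (the_inv_into {1..} f (real (K k))))"
  have w: "w \<longlonglongrightarrow> phi * (dotFhat c - 1)" unfolding w_def by (rule cut_tendsto[OF len])
  have in01: "phi * (dotFhat c - 1) \<in> {0..1}" using cut_limit_bounds[OF s c] by simp
  have iff: "K k < dotF (c @ replicate (level (K k) - s) 0) \<longleftrightarrow> fn_seq f (level (K k)) (q k) < w (level (K k))"
    if "k \<ge> 1" for k
  proof -
    define M where "M = level (K k)"
    have M: "M \<ge> 1" "FF M \<le> K k" "K k < FF (Suc M)"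
      using level_bracket[of "K k"] K(1)[OF that] by (auto simp: M_def)
    have "fn_seq f M (q k) = (real (K k) - real (FF M)) / (real (FF (Suc M)) - real (FF M))"
      using continuation_inverse_of_nat[OF M] fn_seq_eq[OF M(1)] by (simp add: q_def)
    then show ?thesis
      using FF_less_Suc[OF M(1)] unfolding M_def[symmetric] w_def by (simp add: divide_less_cancel)
  qed
  \<comment> \<open>As the levels tend to infinity, what holds for all large \<open>n\<close> may be
    used at \<open>n = level (K k)\<close>.\<close>
  have lim: "filterlim (\<lambda>k. level (K k)) at_top sequentially"
    by (rule filterlim_compose[OF filterlim_level K(2)])
  have ev: "\<forall>\<^sub>F k in sequentially. (q k \<le> g - e \<longrightarrow> K k < dotF (c @ replicate (level (K k) - s) 0)) \<and>
      (K k < dotF (c @ replicate (level (K k) - s) 0) \<longrightarrow> q k \<le> g + e)" if "e > 0" for e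
  proof -
    have "\<forall>\<^sub>F k in sequentially. \<forall>p\<in>{0..1}. (p \<le> g - e \<longrightarrow> fn_seq f (level (K k)) p < w (level (K k))) \<and>
        (fn_seq f (level (K k)) p < w (level (K k)) \<longrightarrow> p \<le> g + e)"
      using fn_seq_threshold[OF w in01 that] lim unfolding g_def by (rule eventually_compose_filterlim)
    then show ?thesis
      using eventually_ge_at_top[of 1]
    proof eventually_elim
      case (elim k)
      have "q k \<in> {0..1}" using frac_lt_1[of "the_inv_into {1..} f (real (K k))"] by (simp add: q_def)
      then show ?case using elim iff[of k] by blast
    qed
  qed
  show ?thesis
    unfolding g_def[symmetric]
  proof (rule frequency_tendsto_sandwich[OF equi])
    show "0 \<le> g" "g \<le> 1" using finf_inverse(1)[OF in01] by (auto simp: g_def)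
    fix e :: real assume "e > 0"
    from ev[OF this] show
      "\<forall>\<^sub>F k in sequentially. frac (the_inv_into {1..} f (real (K k))) \<le> g - e \<longrightarrow>
         K k < dotF (c @ replicate (level (K k) - s) 0)"
      "\<forall>\<^sub>F k in sequentially. K k < dotF (c @ replicate (level (K k) - s) 0) \<longrightarrow>
         frac (the_inv_into {1..} f (real (K k))) \<le> g + e"
      unfolding q_def by (auto elim: eventually_mono)
  qed
qed

lemma frequency_leading_block:
  assumes K: "\<And>n. n \<ge> 1 \<Longrightarrow> K n > 0" "filterlim K at_top sequentially"
    and equi: "equidistributed (\<lambda>n. the_inv_into {1..} f (real (K n)))"
    and s: "s \<ge> 2" and b: "b \<in> FS s"
  shows "(\<lambda>n. real (card {k \<in> {1..n}. LB s (K k) = Some b}) / real n)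
           \<longlonglongrightarrow> the_inv_into {0..1} finf (phi * (dotFhat (btilde s b) - 1))
             - the_inv_into {0..1} finf (phi * (dotFhat b - 1))"
proof -
  define P where "P = (\<lambda>c k. K k < dotF (c @ replicate (level (K k) - s) 0))"
  \<comment> \<open>The second conjunct is eventually redundant; it makes \<open>R\<close> and
    \<open>P b\<close> disjoint at every \<open>k\<close>, so that the counts add exactly.\<close>
  define R where "R = (\<lambda>k. LB s (K k) = Some b \<and> \<not> P b k)"
  have freq: "(\<lambda>n. real (card {k \<in> {1..n}. P c k}) / real n) \<longlonglongrightarrow> the_inv_into {0..1} finf (phi * (dotFhat c - 1))"
    if "c \<in> FS s \<or> c = bspecial s" for c
    unfolding P_def by (rule frequency_below_cut[OF K equi s that])
  have "filterlim (\<lambda>k. level (K k)) at_top sequentially"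
    by (rule filterlim_compose[OF filterlim_level K(2)])
  then have "\<forall>\<^sub>F k in sequentially. s \<le> level (K k)" by (simp add: filterlim_at_top)
  then have ev: "\<forall>\<^sub>F k in sequentially. (P (btilde s b) k \<longleftrightarrow> R k \<or> P b k) \<and> (R k \<longleftrightarrow> LB s (K k) = Some b)"
    using eventually_ge_at_top[of 1]
  proof eventually_elim
    case (elim k)
    then have "FF (level (K k)) \<le> K k" "K k < FF (Suc (level (K k)))"
      using level_bracket[of "K k"] K(1)[of k] by auto
    from less_cut_btilde_iff[OF s b elim(1) this] show ?case unfolding P_def R_def by blast
  qed
  have "(\<lambda>n. real (card {k \<in> {1..n}. R k \<or> P b k}) / real n - real (card {k \<in> {1..n}. P b k}) / real n)
      \<longlonglongrightarrow> the_inv_into {0..1} finf (phi * (dotFhat (btilde s b) - 1))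
        - the_inv_into {0..1} finf (phi * (dotFhat b - 1))"
    using ev b
    by (intro tendsto_diff freq frequency_cong[OF _ freq[OF btilde_cases(1)[OF s b]]]) (auto elim: eventually_mono)
  moreover have "real (card {k \<in> {1..n}. R k \<or> P b k}) = real (card {k \<in> {1..n}. R k}) + real (card {k \<in> {1..n}. P b k})" for n
  proof -
    have "{k \<in> {1..n}. R k \<or> P b k} = {k \<in> {1..n}. R k} \<union> {k \<in> {1..n}. P b k}" by auto
    moreover have "{k \<in> {1..n}. R k} \<inter> {k \<in> {1..n}. P b k} = {}" by (auto simp: R_def)
    ultimately show ?thesis by (simp add: card_Un_disjoint)
  qed
  ultimately have R: "(\<lambda>n. real (card {k \<in> {1..n}. R k}) / real n)
      \<longlonglongrightarrow> the_inv_into {0..1} finf (phi * (dotFhat (btilde s b) - 1))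
        - the_inv_into {0..1} finf (phi * (dotFhat b - 1))"
    by (simp add: add_divide_distrib)
  from ev have "\<forall>\<^sub>F k in sequentially. LB s (K k) = Some b \<longleftrightarrow> R k"
    by (rule eventually_mono) blast
  then show ?thesis using R by (rule frequency_cong)
qed

section \<open>The explicit sequence of the first claim\<close>

lemma fn_seq_in_unit:
  assumes "n \<ge> 1" "p \<in> {0..1}"
  shows "fn_seq f n p \<in> {0..1}"
proof -
  have "f (real n) \<le> f (real n + p)" "f (real n + p) \<le> f (real n + 1)" "f (real n) < f (real n + 1)"
    using assms continuation_less_iff[of "real n + p" "real n"]
      continuation_less_iff[of "real n + 1" "real n + p"] continuation_less_iff[of "real n" "real n + 1"]
    by (auto simp: not_less[symmetric])
  then show ?thesis by (simp add: fn_seq_def divide_le_eq)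
qed

lemma FrakF_transfer:
  assumes "n \<ge> 1" "p \<in> {0..1}"
  shows "FrakF (real n + the_inv_into {0..1} (FrakFn n) (fn_seq f n p)) = f (real n + p)"
  using FrakF_inverse[OF assms(1) fn_seq_in_unit[OF assms]] FF_less_Suc[OF assms(1)]
  by (simp add: fn_seq_eq[OF assms(1)])

text \<open>Since \<open>FF n\<close> is an integer, rounding down cannot leave level
  \<open>n\<close>.\<close>

lemma floor_continuation_bounds:
  assumes n: "n \<ge> 1" and p: "0 \<le> p" "p < 1" and m: "m = nat \<lfloor>f (real n + p)\<rfloor>"
  shows "FF n \<le> m" "m < FF (Suc n)" "real m \<le> f (real n + p)" "f (real n + p) < real m + 1"
proof -
  have "real (FF n) \<le> f (real n + p)"
    using n p continuation_less_iff[of "real n + p" "real n"] continuation_of_nat[OF n]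
    by (auto simp: not_less[symmetric])
  moreover have "f (real n + p) < real (FF (Suc n))"
    using n p continuation_less_iff[of "real n + p" "real n + 1"] continuation_of_nat[of "Suc n"]
    by (simp add: add.commute)
  ultimately show "FF n \<le> m" "m < FF (Suc n)" "real m \<le> f (real n + p)" "f (real n + p) < real m + 1"
    unfolding m by (auto simp: le_nat_iff le_floor_iff nat_less_iff floor_less_iff)
qed

text \<open>Rounding down moves the fractional part to the left, which gives one comparison at once.
  It cannot move it far: a displacement of more than \<open>e\<close> across \<open>\<beta>\<close>
  would force a definite gap in \<open>finf\<close>, while rounding changes
  \<open>fn_seq f n\<close> by a vanishing amount.\<close>

lemma equidistributed_floor_continuation:
  assumes x: "equidistributed x" and K: "\<And>n. n \<ge> 1 \<Longrightarrow> K n = nat \<lfloor>f (real n + frac (x n))\<rfloor>"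
  shows "equidistributed (\<lambda>n. the_inv_into {1..} f (real (K n)))"
  unfolding equidistributed_def
proof
  fix \<beta> :: real assume "\<beta> \<in> {0..1}"
  then have b: "0 \<le> \<beta>" "\<beta> \<le> 1" by auto
  define q where "q = (\<lambda>n. frac (the_inv_into {1..} f (real (K n))))"
  have q: "0 \<le> q n" "q n < 1" for n by (simp_all add: q_def frac_lt_1)
  note Kb = floor_continuation_bounds[OF _ frac_ge_0 frac_lt_1 K]
  have fq: "f (real n + q n) = real (K n)" if "n \<ge> 1" for n
    unfolding q_def using that Kb[OF that that] by (intro continuation_inverse_of_nat) auto
  have le: "q n \<le> frac (x n)" if "n \<ge> 1" for n
  proof -
    have "1 \<le> real n + frac (x n)" "1 \<le> real n + q n" using that q[of n] frac_ge_0[of "x n"] by linarith+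
    from continuation_less_iff[OF this] show ?thesis
      using Kb(3)[OF that that] fq[OF that] by (auto simp: not_less[symmetric])
  qed
  have "(\<lambda>n. real (card {k \<in> {1..n}. q k \<le> \<beta>}) / real n) \<longlonglongrightarrow> \<beta>"
  proof (rule frequency_tendsto_sandwich[OF x b])
    fix e :: real assume e: "e > 0"
    show "\<forall>\<^sub>F k in sequentially. frac (x k) \<le> \<beta> - e \<longrightarrow> q k \<le> \<beta>"
      using eventually_ge_at_top[of 1] by eventually_elim (use le e in force)
    show "\<forall>\<^sub>F k in sequentially. q k \<le> \<beta> \<longrightarrow> frac (x k) \<le> \<beta> + e"
    proof (cases "\<beta> + e \<ge> 1")
      case True
      have "frac (x k) \<le> \<beta> + e" for k using True frac_lt_1[of "x k"] by linarith
      then show ?thesis by simp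
    next
      case False
      \<comment> \<open>One third of the gap is for the rounding, and one third for each of the two
        uniform approximations.\<close>
      define h where "h = finf (\<beta> + e) - finf \<beta>"
      have h: "h > 0" using finf_less[of \<beta> "\<beta> + e"] False e b by (simp add: h_def)
      have "(\<lambda>n. 1 / real (n - 1)) \<longlonglongrightarrow> 0"
        by (rule LIMSEQ_offset[of _ 1]) (use lim_const_over_n[of "1::real"] in simp)
      then have "\<forall>\<^sub>F n in sequentially. 1 / real (n - 1) < h / 3" using h by (intro order_tendstoD) auto
      moreover have "\<forall>\<^sub>F n in sequentially. \<forall>p\<in>{0..1}. \<bar>fn_seq f n p - finf p\<bar> < h / 3"
        using h by (intro fn_seq_uniform) simp
      ultimately show ?thesis using eventually_ge_at_top[of 2]
      proof eventually_elim
        case (elim n)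
        then have n: "n \<ge> 1" by simp
        obtain r where r: "n = Suc (Suc r)" using elim(3) by (auto simp: numeral_2_eq_2 Suc_le_eq dest!: less_imp_Suc_add)
        \<comment> \<open>The difference is \<open>FF (n - 1)\<close> by the recursion, and this is
          at least \<open>n - 1\<close>.\<close>
        have d: "real (n - 1) \<le> real (FF (Suc n)) - real (FF n)"
          using FF_ge_self[of "n - 1"] r by simp
        have n1: "real (n - 1) > 0" using r by simp
        have "fn_seq f n (frac (x n)) - fn_seq f n (q n) =
            (f (real n + frac (x n)) - real (K n)) / (real (FF (Suc n)) - real (FF n))"
          by (simp add: fn_seq_eq[OF n] fq[OF n] diff_divide_distrib)
        also have "\<dots> \<le> 1 / real (n - 1)"
          using Kb(3,4)[OF n n] d n1 by (intro frac_le) auto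
        finally have diff: "fn_seq f n (frac (x n)) - fn_seq f n (q n) < h / 3" using elim(1) by (rule le_less_trans)
        show ?case
        proof (intro impI, rule ccontr)
          assume qb: "q n \<le> \<beta>" and "\<not> frac (x n) \<le> \<beta> + e"
          then have "finf (\<beta> + e) \<le> finf (frac (x n))"
            using b e frac_lt_1[of "x n"] by (intro finf_le) auto
          moreover have "finf (q n) \<le> finf \<beta>" using qb b q[of n] by (intro finf_le) auto
          moreover have "\<bar>fn_seq f n (frac (x n)) - finf (frac (x n))\<bar> < h / 3" "\<bar>fn_seq f n (q n) - finf (q n)\<bar> < h / 3"
            using elim(2) q[of n] frac_lt_1[of "x n"] by (auto simp: less_imp_le)
          then have "finf (frac (x n)) < fn_seq f n (frac (x n)) + h / 3" "fn_seq f n (q n) < finf (q n) + h / 3"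
            by linarith+
          ultimately show False using diff by (simp add: h_def field_simps)
        qed
      qed
    qed
  qed
  then show "(\<lambda>n. real (card {k \<in> {1..n}. frac (the_inv_into {1..} f (real (K k))) \<le> \<beta>}) / real n) \<longlonglongrightarrow> \<beta>"
    unfolding q_def .
qed

end

theorem theorem5p6:
  fixes f finf :: "real \<Rightarrow> real"
  assumes "uniform_continuation f finf"
  shows "(let K = (\<lambda>n::nat. nat \<lfloor>FrakF (real n + the_inv_into {0..1} (FrakFn n)
                                   (fn_seq f n (frac (real n * pi))))\<rfloor>)
          in (\<forall>n\<ge>1. K n > 0) \<and> filterlim K at_top sequentially \<and>
             equidistributed (\<lambda>n. the_inv_into {1..} f (real (K n))))
       \<and> (\<forall>(K :: nat \<Rightarrow> nat) s b.
            (\<forall>n\<ge>1. K n > 0) \<longrightarrow> filterlim K at_top sequentially \<longrightarrow>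
            equidistributed (\<lambda>n. the_inv_into {1..} f (real (K n))) \<longrightarrow>
            s \<ge> 2 \<longrightarrow> b \<in> FS s \<longrightarrow>
            ((\<lambda>n. real (card {k \<in> {1..n}. LB s (K k) = Some b}) / real n)
               \<longlonglongrightarrow> (the_inv_into {0..1} finf (FrakFinf (log phi (dotFhat (btilde s b))))
                   - the_inv_into {0..1} finf (FrakFinf (log phi (dotFhat b)))))
            \<and> (the_inv_into {0..1} finf (FrakFinf (log phi (dotFhat (btilde s b))))
                   - the_inv_into {0..1} finf (FrakFinf (log phi (dotFhat b)))
               = the_inv_into {0..1} finf (phi * (dotFhat (btilde s b) - 1))
                   - the_inv_into {0..1} finf (phi * (dotFhat b - 1))))"
proof -
  define K where "K = (\<lambda>n::nat. nat \<lfloor>FrakF (real n + the_inv_into {0..1} (FrakFn n)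
                                   (fn_seq f n (frac (real n * pi))))\<rfloor>)"
  have K: "K n = nat \<lfloor>f (real n + frac (real n * pi))\<rfloor>" if "n \<ge> 1" for n
    using FrakF_transfer[OF assms that, of "frac (real n * pi)"] frac_lt_1[of "real n * pi"]
    by (simp add: K_def less_imp_le)
  have FK: "FF n \<le> K n" if "n \<ge> 1" for n
    using floor_continuation_bounds(1)[OF assms that frac_ge_0 frac_lt_1 K[OF that]] .
  have K_pos: "\<forall>n\<ge>1. K n > 0" using less_le_trans[OF FF_pos FK] by blast
  have K_top: "filterlim K at_top sequentially"
  proof (rule filterlim_at_top_mono[OF filterlim_ident])
    show "\<forall>\<^sub>F n in sequentially. n \<le> K n"
      using eventually_ge_at_top[of 1] by eventually_elim (rule order_trans[OF FF_ge_self FK])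
  qed
  have K_equi: "equidistributed (\<lambda>n. the_inv_into {1..} f (real (K n)))"
    by (rule equidistributed_floor_continuation[OF assms equidistributed_mult_irrational[OF pi_irrational] K])
  \<comment> \<open>The limit of a normalised cut is nonnegative, so
    \<open>dotFhat c \<ge> 1\<close>. The argument of the logarithm is thus positive, and
    \<open>phi powr\<close> cancels it.\<close>
  have Finf: "FrakFinf (log phi (dotFhat c)) = phi * (dotFhat c - 1)"
    if "s \<ge> 2" "c \<in> FS s \<or> c = bspecial s" for s c
  proof -
    have "dotFhat c \<ge> 1"
      using cut_limit_bounds(1)[OF that] phi_gt_1 by (simp add: zero_le_mult_iff)
    then show ?thesis using phi_gt_1 by (simp add: FrakFinf_def)
  qed
  show ?thesis
    unfolding Let_def K_def[symmetric]
  proof (intro conjI allI impI)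
    fix L :: "nat \<Rightarrow> nat" and s b
    assume L: "\<forall>n\<ge>1. L n > 0" "filterlim L at_top sequentially"
      "equidistributed (\<lambda>n. the_inv_into {1..} f (real (L n)))" and s: "s \<ge> 2" and b: "b \<in> FS s"
    have eq: "FrakFinf (log phi (dotFhat b)) = phi * (dotFhat b - 1)"
      "FrakFinf (log phi (dotFhat (btilde s b))) = phi * (dotFhat (btilde s b) - 1)"
      using Finf[OF s] b btilde_cases(1)[OF s b] by auto
    show "the_inv_into {0..1} finf (FrakFinf (log phi (dotFhat (btilde s b))))
        - the_inv_into {0..1} finf (FrakFinf (log phi (dotFhat b)))
      = the_inv_into {0..1} finf (phi * (dotFhat (btilde s b) - 1))
        - the_inv_into {0..1} finf (phi * (dotFhat b - 1))"
      unfolding eq ..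
    show "(\<lambda>n. real (card {k \<in> {1..n}. LB s (L k) = Some b}) / real n)
        \<longlonglongrightarrow> the_inv_into {0..1} finf (FrakFinf (log phi (dotFhat (btilde s b))))
          - the_inv_into {0..1} finf (FrakFinf (log phi (dotFhat b)))"
      unfolding eq by (rule frequency_leading_block[OF assms _ L(2,3) s b]) (use L(1) in blast)
  qed (use K_pos in blast, rule K_top, rule K_equi)
qed

end
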